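(* Let $\nu$ be real. Then the following assertions are true. (a) If $\nu\in(-1,0)$, then the radius of starlikeness of $f_\nu$ is $r^*(f_\nu)=x_{\nu,0}$, where $x_{\nu,0}$ is the unique positive root of the equation $I_\nu'(z)=0$. If $\nu>0$, then the radius of starlikeness of $f_\nu$ is $r^*(f_\nu)=x_{\nu,0,1}$, which denotes the smallest positive root of the equation $J_\nu'(z)=0$. (b) If $\nu>-1$, then the radius of starlikeness of $g_\nu$ is $r^*(g_\nu)=y_{\nu,0,1}$, which denotes the smallest positive root of the equation $zJ_\nu'(z)+(1-\nu)J_\nu(z)=0$. (c) If $\nu>-1$, then the radius of starlikeness of $h_\nu$ is $r^*(h_\nu)=z_{\nu,0,1}$, which denotes the smallest positive root of the equation $zJ_\nu'(z)+(2-\nu)J_\nu(z)=0$.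
   Context: $\mathbf{D}(0,r)=\{z\in\mathbb{C}:|z|<r\}$. $J_\nu$ is the Bessel function of the first kind, $$J_\nu(z)=\sum_{n\ge 0}\frac{(-1)^n}{n!\,\Gamma(n+\nu+1)}\left(\frac z2\right)^{2n+\nu},$$ and $I_\nu$ is the modified Bessel function of the first kind, $$I_\nu(z)=\sum_{n\ge 0}\frac{1}{n!\,\Gamma(n+\nu+1)}\left(\frac z2\right)^{2n+\nu}$$ (formally $I_\nu(z)=\mathrm{i}^{-\nu}J_\nu(\mathrm{i}z)$). For real $\nu>-1$ all zeros of the entire function $z\mapsto z^{-\nu}J_\nu(z)$ are real, and $j_{\nu,1}$ denotes the smallest positive zero of $J_\nu$. The normalized Bessel functions are $$f_\nu(z)=\left[2^\nu\Gamma(\nu+1)J_\nu(z)\right]^{1/\nu}\ (\nu\ne 0),\quad g_\nu(z)=2^\nu\Gamma(\nu+1)z^{1-\nu}J_\nu(z),\quad h_\nu(z)=2^\nu\Gamma(\nu+1)z^{1-\nu/2}J_\nu(\sqrt z).$$ All three are normalized analytic functions near $0$: $f(0)=0$, $f'(0)=1$. The functions $g_\nu$ and $h_\nu$ are understood as entire functions (the powers of $z$ cancel): $g_\nu(z)=z\Lambda_\nu(z)$ with $\Lambda_\nu(z)=2^\nu\Gamma(\nu+1)z^{-\nu}J_\nu(z)$ (entire and even, $\Lambda_\nu(0)=1$), and $h_\nu(z)=z\Lambda_\nu(\sqrt z)$. The function $f_\nu$ is understood as $f_\nu(z)=z\,[\Lambda_\nu(z)]^{1/\nu}=z\exp\left(\frac1\nu\log\Lambda_\nu(z)\right)$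 on $\mathbf{D}(0,j_{\nu,1})$, where $\log\Lambda_\nu$ is the analytic branch vanishing at $0$; in particular $zf_\nu'(z)/f_\nu(z)=\frac1\nu\, zJ_\nu'(z)/J_\nu(z)$. For a function $f$ analytic near $0$ with $f(0)=f'(0)-1=0$, the radius of starlikeness is $$r^*(f)=\sup\left\{r>0:\ \operatorname{Re}\left[\frac{zf'(z)}{f(z)}\right]>0\ \text{ for all } z\in\mathbf{D}(0,r)\right\},$$ where $zf'(z)/f(z)$ is given its limiting value $1$ at $z=0$, and the condition for a given $r$ includes that $f$ is analytic in $\mathbf{D}(0,r)$ and nonvanishing there except at $0$ (the radius may be larger or smaller than $1$).
   Formalization: In (c) the radius of starlikeness of h_ν is stated as the square of z_{ν,0,1}, not z_{ν,0,1} itself; as printed (c) is false, e.g. for ν=1/2, where z_{ν,0,1}≈2.029 but r*(h_ν)≈4.116. *)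

theory Defs
  imports "HOL-Complex_Analysis.Complex_Analysis"
begin

text \<open>
  Principal branch of \<open>z\<^sup>a\<close> for real \<open>a\<close>. The case distinction gives \<open>0\<^sup>0 = 1\<close>, whereas
  \<open>0 powr 0 = 0\<close>; it matters only for the value of the series of order \<open>0\<close> at \<open>z = 0\<close>.
\<close>
definition real_exponent_power :: "complex \<Rightarrow> real \<Rightarrow> complex" where
  "real_exponent_power z a = (if a = 0 then 1 else z powr of_real a)"

definition Bessel_J :: "real \<Rightarrow> complex \<Rightarrow> complex" where
  "Bessel_J \<nu> z = (\<Sum>n. (-1) ^ n / (fact n * Gamma (of_nat n + of_real \<nu> + 1))
                        * real_exponent_power (z / 2) (2 * real n + \<nu>))"

definition Bessel_I :: "real \<Rightarrow> complex \<Rightarrow> complex" where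
  "Bessel_I \<nu> z = (\<Sum>n. 1 / (fact n * Gamma (of_nat n + of_real \<nu> + 1))
                        * real_exponent_power (z / 2) (2 * real n + \<nu>))"

definition is_smallest_positive_root :: "(complex \<Rightarrow> complex) \<Rightarrow> real \<Rightarrow> bool" where
  "is_smallest_positive_root F x \<longleftrightarrow>
     x > 0 \<and> F (of_real x) = 0 \<and> (\<forall>y::real. 0 < y \<and> F (of_real y) = 0 \<longrightarrow> x \<le> y)"

definition is_unique_positive_root :: "(complex \<Rightarrow> complex) \<Rightarrow> real \<Rightarrow> bool" where
  "is_unique_positive_root F x \<longleftrightarrow>
     x > 0 \<and> F (of_real x) = 0 \<and> (\<forall>y::real. 0 < y \<and> F (of_real y) = 0 \<longrightarrow> y = x)"

definition Bessel_J_first_zero :: "real \<Rightarrow> real" where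
  "Bessel_J_first_zero \<nu> = (THE x. is_smallest_positive_root (Bessel_J \<nu>) x)"

text \<open>
  For \<open>z \<noteq> 0\<close> the branch cuts of the two factors cancel, so for \<open>\<nu> > -1\<close> this is an entire
  even function, with the removable singularity at \<open>0\<close> filled in.
\<close>
definition Bessel_Lambda :: "real \<Rightarrow> complex \<Rightarrow> complex" where
  "Bessel_Lambda \<nu> z =
     (if z = 0 then 1
      else of_real (2 powr \<nu> * Gamma (\<nu> + 1)) * z powr of_real (- \<nu>) * Bessel_J \<nu> z)"

text \<open>
  The analytic logarithm on the disc of radius \<open>j\<^sub>\<nu>\<^sub>,\<^sub>1\<close>; the three conditions determine
  it uniquely there, and its values elsewhere are never used.
\<close>
definition log_Bessel_Lambda :: "real \<Rightarrow> complex \<Rightarrow> complex" where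
  "log_Bessel_Lambda \<nu> =
     (SOME L. L holomorphic_on ball 0 (Bessel_J_first_zero \<nu>) \<and> L 0 = 0 \<and>
              (\<forall>z \<in> ball 0 (Bessel_J_first_zero \<nu>). exp (L z) = Bessel_Lambda \<nu> z))"

text \<open>
  This function lives on the disc of radius \<open>j\<^sub>\<nu>\<^sub>,\<^sub>1\<close>. It is extended by \<open>0\<close>, so that
  a larger disc violates the nonvanishing condition in \<open>starlike_on_disc\<close> below.
\<close>
definition Bessel_f :: "real \<Rightarrow> complex \<Rightarrow> complex" where
  "Bessel_f \<nu> z =
     (if z \<in> ball 0 (Bessel_J_first_zero \<nu>)
      then z * exp (of_real (1 / \<nu>) * log_Bessel_Lambda \<nu> z) else 0)"

definition Bessel_g :: "real \<Rightarrow> complex \<Rightarrow> complex" where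
  "Bessel_g \<nu> z = z * Bessel_Lambda \<nu> z"

text \<open>
  Independent of the branch of the square root, since \<open>Bessel_Lambda \<nu>\<close> is even. With
  \<open>w\<^sup>2 = z\<close> one has \<open>z h'(z) / h(z) = (w J'(w) + (2 - \<nu>) J(w)) / (2 J(w))\<close>: if \<open>w\<close> is the smallest
  positive root of the numerator, then the radius of starlikeness is \<open>w\<^sup>2\<close>, not \<open>w\<close>.
\<close>
definition Bessel_h :: "real \<Rightarrow> complex \<Rightarrow> complex" where
  "Bessel_h \<nu> z = z * Bessel_Lambda \<nu> (csqrt z)"

definition starlike_quotient :: "(complex \<Rightarrow> complex) \<Rightarrow> complex \<Rightarrow> complex" where
  "starlike_quotient f z = (if z = 0 then 1 else z * deriv f z / f z)"

definition starlike_on_disc :: "(complex \<Rightarrow> complex) \<Rightarrow> real \<Rightarrow> bool" where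
  "starlike_on_disc f r \<longleftrightarrow>
     f holomorphic_on ball 0 r \<and>
     (\<forall>z \<in> ball 0 r - {0}. f z \<noteq> 0) \<and>
     (\<forall>z \<in> ball 0 r. Re (starlike_quotient f z) > 0)"

text \<open>
  Meaningful for \<open>f\<close> analytic near \<open>0\<close> with \<open>f 0 = 0\<close> and \<open>f'(0) = 1\<close>. The supremum is taken
  in the extended reals, so that it is not an unspecified value for unbounded sets.
\<close>
definition radius_of_starlikeness :: "(complex \<Rightarrow> complex) \<Rightarrow> ereal" where
  "radius_of_starlikeness f = Sup (ereal ` {r. r > 0 \<and> starlike_on_disc f r})"

end

theory Submission
  imports Defs "HOL-Real_Asymp.Real_Asymp"
begin

text \<open>
  Write \<open>Bessel_Lambda \<nu> z = \<Phi>(z\<^sup>2)\<close> with \<open>\<Phi>\<close> entire, \<open>V = -\<Phi>'/\<Phi>\<close> and \<open>Q(w) = w V(w)\<close>. The starlike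
  quotients of \<open>f\<close>, \<open>g\<close>, \<open>h\<close> are \<open>1 - (2/\<nu>) Q(z\<^sup>2)\<close>, \<open>1 - 2 Q(z\<^sup>2)\<close> and \<open>1 - Q(z)\<close>. Bessel's equation
  becomes the Riccati equation \<open>w V' = 1/4 - (\<nu>+1) V + w V\<^sup>2\<close>, from which the Taylor coefficients of
  \<open>V\<close> are positive. Hence \<open>|Q(w)| \<le> Q(|w|)\<close> up to the first zero \<open>R = j\<^sub>\<nu>\<^sub>,\<^sub>1\<^sup>2\<close> of \<open>\<Phi>\<close>, which lies on the
  positive axis, and \<open>Q\<close> increases there from 0 to infinity. This replaces the Hadamard factorization
  and settles all cases but \<open>f\<close> with \<open>\<nu> < 0\<close>. In that case one needs a lower bound for the real part of
  \<open>P = Q - \<nu>/2\<close>: at a first point \<open>w\<close> where it vanishes \<open>w P'(w)\<close> is real, and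
  \<open>w P' = P\<^sup>2 + (w - \<nu>\<^sup>2)/4\<close> makes \<open>w\<close> real, hence negative, which gives a zero of \<open>I\<^sub>\<nu>'\<close>. Such a point
  exists inside the disc of radius \<open>R\<close>, because the residue of \<open>P\<close> at \<open>R\<close> is too large
  for a function with positive real part and \<open>P(0) = -\<nu>/2 < 1/2\<close>.
\<close>

subsection \<open>The even entire part of the Bessel function\<close>

locale Bessel_order =
  fixes \<nu> :: real
  assumes order_gt: "-1 < \<nu>"
begin

text \<open>The hypergeometric series 0F1(; \<nu>+1; -z/4).\<close>

definition Phi_fps :: "complex fps" where
  "Phi_fps = Abs_fps (\<lambda>n. (-1) ^ n / (4 ^ n * fact n * pochhammer (of_real (\<nu> + 1)) n))"

definition Phi :: "complex \<Rightarrow> complex" where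
  "Phi = eval_fps Phi_fps"

definition Phi' :: "complex \<Rightarrow> complex" where
  "Phi' = eval_fps (fps_deriv Phi_fps)"

lemma pochhammer_order_nonzero: "pochhammer (of_real (\<nu> + 1) :: complex) n \<noteq> 0"
proof -
  have "pochhammer (\<nu> + 1) n > 0"
    using order_gt by (intro pochhammer_pos) auto
  then show ?thesis
    by (metis of_real_eq_0_iff order_less_irrefl pochhammer_of_real)
qed

lemma order_plus_nonzero: "of_real (\<nu> + 1) + of_nat n \<noteq> (0 :: complex)"
proof -
  have "of_real (\<nu> + 1) + of_nat n = (of_real (\<nu> + 1 + real n) :: complex)"
    by simp
  moreover have "\<nu> + 1 + real n \<noteq> 0"
    using order_gt by linarith
  ultimately show ?thesis
    by (metis of_real_eq_0_iff)
qed

lemma Phi_fps_nth_Suc: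
  "4 * of_nat (Suc n) * (of_real (\<nu> + 1) + of_nat n) * fps_nth Phi_fps (Suc n) = - fps_nth Phi_fps n"
  using pochhammer_order_nonzero[of n] order_plus_nonzero[of n]
  by (simp add: Phi_fps_def pochhammer_Suc divide_simps del: of_nat_Suc of_real_add)

lemma Phi_fps_nth_0 [simp]: "fps_nth Phi_fps 0 = 1"
  by (simp add: Phi_fps_def)

lemma Phi_fps_nth_nonzero: "fps_nth Phi_fps n \<noteq> 0"
  using pochhammer_order_nonzero[of n] by (simp add: Phi_fps_def)

lemma conv_radius_Phi [simp]: "fps_conv_radius Phi_fps = \<infinity>"
  unfolding fps_conv_radius_def
proof (rule conv_radius_ratio_limit_ereal_nonzero)
  have eq: "norm (fps_nth Phi_fps n) / norm (fps_nth Phi_fps (Suc n))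
      = 4 * real (Suc n) * (\<nu> + 1 + real n)" for n
  proof -
    have "norm (fps_nth Phi_fps n)
        = norm (4 * of_nat (Suc n) * (of_real (\<nu> + 1) + of_nat n) * fps_nth Phi_fps (Suc n))"
      unfolding Phi_fps_nth_Suc by simp
    also have "of_real (\<nu> + 1) + of_nat n = (of_real (\<nu> + 1 + real n) :: complex)"
      by simp
    also have "norm (4 * of_nat (Suc n) * complex_of_real (\<nu> + 1 + real n) * fps_nth Phi_fps (Suc n))
        = 4 * real (Suc n) * (\<nu> + 1 + real n) * norm (fps_nth Phi_fps (Suc n))"
      using order_gt by (simp add: norm_mult del: of_nat_Suc of_real_add)
    finally show ?thesis
      using Phi_fps_nth_nonzero[of "Suc n"] by simp
  qed
  have "filterlim (\<lambda>n. 4 * real (Suc n) * (\<nu> + 1 + real n)) at_top sequentially"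
    by real_asymp
  then show "(\<lambda>n. ereal (norm (fps_nth Phi_fps n) / norm (fps_nth Phi_fps (Suc n)))) \<longlonglongrightarrow> \<infinity>"
    unfolding eq by (simp add: tendsto_PInfty_eq_at_top)
qed simp

lemma conv_radius_Phi_deriv [simp]: "fps_conv_radius ((fps_deriv ^^ n) Phi_fps) = \<infinity>"
proof (induction n)
  case (Suc n)
  then show ?case
    using fps_conv_radius_deriv[of "(fps_deriv ^^ n) Phi_fps"] by simp
qed simp

lemma conv_radius_Phi' [simp]: "fps_conv_radius (fps_deriv Phi_fps) = \<infinity>"
  using conv_radius_Phi_deriv[of 1] by simp

lemma has_derivative_Phi: "(Phi has_field_derivative Phi' z) (at z within A)"
  unfolding Phi_def Phi'_def by (rule has_field_derivative_eval_fps) simp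

lemma deriv_Phi: "deriv Phi z = Phi' z"
  by (rule DERIV_imp_deriv[OF has_derivative_Phi])

lemma holomorphic_Phi: "Phi holomorphic_on A"
  unfolding Phi_def by (rule holomorphic_on_eval_fps) auto

lemma holomorphic_Phi': "Phi' holomorphic_on A"
  unfolding Phi'_def by (rule holomorphic_on_eval_fps) auto

lemma continuous_on_Phi: "continuous_on A Phi"
  by (rule holomorphic_on_imp_continuous_on[OF holomorphic_Phi])

lemma continuous_on_Phi': "continuous_on A Phi'"
  by (rule holomorphic_on_imp_continuous_on[OF holomorphic_Phi'])

lemma Phi_0 [simp]: "Phi 0 = 1"
  by (simp add: Phi_def eval_fps_at_0)

lemma Phi_sums: "(\<lambda>n. fps_nth Phi_fps n * z ^ n) sums Phi z"
  unfolding Phi_def by (rule sums_eval_fps) simp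

lemma higher_deriv_Phi: "(deriv ^^ n) Phi z = eval_fps ((fps_deriv ^^ n) Phi_fps) z"
proof (induction n arbitrary: z)
  case 0
  show ?case by (simp add: Phi_def)
next
  case (Suc n)
  have "(deriv ^^ n) Phi = eval_fps ((fps_deriv ^^ n) Phi_fps)"
    using Suc by blast
  then have "(deriv ^^ Suc n) Phi z = deriv (eval_fps ((fps_deriv ^^ n) Phi_fps)) z"
    by simp
  also have "\<dots> = eval_fps (fps_deriv ((fps_deriv ^^ n) Phi_fps)) z"
    by (subst eval_fps_deriv) auto
  finally show ?case by simp
qed

text \<open>For \<open>n = 0\<close> this is Bessel's equation in the variable
  \<open>w = z\<^sup>2\<close>, equivalent to the coefficient recursion; each induction step
  differentiates it once.\<close>

lemma Phi_fps_ode: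
  "fps_X * (fps_deriv ^^ (n + 2)) Phi_fps
     + fps_const (of_real (\<nu> + 1) + of_nat n) * (fps_deriv ^^ (n + 1)) Phi_fps
     + fps_const (1/4) * (fps_deriv ^^ n) Phi_fps = 0"
proof (induction n)
  case 0
  show ?case
  proof (rule fps_ext)
    fix m :: nat
    have "4 * (of_nat m * (of_nat (Suc m) * fps_nth Phi_fps (Suc m))
        + of_real (\<nu> + 1) * (of_nat (Suc m) * fps_nth Phi_fps (Suc m)) + fps_nth Phi_fps m / 4) = 0"
      using Phi_fps_nth_Suc[of m] by (simp add: algebra_simps)
    then have "of_nat m * (of_nat (Suc m) * fps_nth Phi_fps (Suc m))
        + of_real (\<nu> + 1) * (of_nat (Suc m) * fps_nth Phi_fps (Suc m)) + fps_nth Phi_fps m / 4 = 0"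
      by (simp only: mult_eq_0_iff) simp
    then show "fps_nth (fps_X * (fps_deriv ^^ (0 + 2)) Phi_fps
        + fps_const (of_real (\<nu> + 1) + of_nat 0) * (fps_deriv ^^ (0 + 1)) Phi_fps
        + fps_const (1/4) * (fps_deriv ^^ 0) Phi_fps) m = fps_nth 0 m"
      by (cases m) (simp_all add: numeral_2_eq_2 algebra_simps)
  qed
next
  case (Suc n)
  let ?D = "\<lambda>k. (fps_deriv ^^ k) Phi_fps"
  have "fps_deriv (fps_X * ?D (n + 2) + fps_const (of_real (\<nu> + 1) + of_nat n) * ?D (n + 1)
      + fps_const (1/4) * ?D n) = 0"
    unfolding Suc by simp
  then show ?case
    by (simp add: algebra_simps numeral_fps_const flip: fps_const_add)
qed

lemma Phi_ode:
  "z * (deriv ^^ (n + 2)) Phi z + (of_real (\<nu> + 1) + of_nat n) * (deriv ^^ (n + 1)) Phi z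
     + (deriv ^^ n) Phi z / 4 = 0"
proof -
  define D where "D = (\<lambda>k. (fps_deriv ^^ k) Phi_fps)"
  have D: "fps_conv_radius (D m) = \<infinity>" for m
    by (simp add: D_def)
  have rad: "fps_conv_radius (fps_X * D m) = \<infinity>" "fps_conv_radius (fps_const c * D m) = \<infinity>" for c m
    using fps_conv_radius_mult[of fps_X "D m"] fps_conv_radius_mult[of "fps_const c" "D m"]
    by (simp_all add: D)
  have rad2: "fps_conv_radius (fps_X * D k + fps_const c * D m) = \<infinity>" for c k m
    using fps_conv_radius_add[of "fps_X * D k" "fps_const c * D m"]
    unfolding rad min.idem ereal_infty_less_eq(1) .
  have "eval_fps (fps_X * D (n + 2) + fps_const (of_real (\<nu> + 1) + of_nat n) * D (n + 1)
     + fps_const (1/4) * D n) z = 0"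
    unfolding Phi_fps_ode D_def by simp
  then have "z * eval_fps (D (n + 2)) z + (of_real (\<nu> + 1) + of_nat n) * eval_fps (D (n + 1)) z
     + eval_fps (D n) z / 4 = 0"
    by (simp add: eval_fps_add eval_fps_mult D rad rad2)
  then show ?thesis
    unfolding higher_deriv_Phi D_def .
qed

text \<open>At a double zero \<open>z\<close>, which is not 0, the equations \<open>Phi_ode\<close>
  can be solved for the highest derivative. So all derivatives vanish there, and the identity
  theorem contradicts \<open>Phi 0 = 1\<close>.\<close>

lemma Phi_zero_simple:
  assumes "Phi z = 0"
  shows "Phi' z \<noteq> 0"
proof
  assume d: "Phi' z = 0"
  have z: "z \<noteq> 0"
    using assms by auto
  have "(deriv ^^ n) Phi z = 0 \<and> (deriv ^^ Suc n) Phi z = 0" for n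
  proof (induction n)
    case 0
    then show ?case using assms d by (simp add: deriv_Phi)
  next
    case (Suc n)
    then show ?case
      using Phi_ode[of z n] z by simp
  qed
  then have "Phi 0 = 0"
    using holomorphic_fun_eq_0_on_connected[of Phi UNIV z 0] holomorphic_Phi by auto
  then show False by simp
qed

subsection \<open>The logarithmic derivative and its Taylor coefficients\<close>

definition V_fps :: "complex fps" where
  "V_fps = - fps_deriv Phi_fps * inverse Phi_fps"

lemma V_fps_mult: "V_fps * Phi_fps = - fps_deriv Phi_fps"
proof -
  have "inverse Phi_fps * Phi_fps = 1"
    by (rule inverse_mult_eq_1) simp
  then show ?thesis
    by (simp add: V_fps_def mult.assoc)
qed

text \<open>Substitute \<open>Phi' = - V * Phi\<close> into the second-order equation and cancel the
  nonzero series \<open>Phi_fps\<close>.\<close>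

lemma V_fps_riccati:
  "fps_X * fps_deriv V_fps = fps_const (1/4) - fps_const (of_real (\<nu> + 1)) * V_fps + fps_X * V_fps\<^sup>2"
proof -
  let ?F = Phi_fps
  define c where "c = fps_const (of_real (\<nu> + 1) :: complex)"
  have ode: "fps_X * fps_deriv (fps_deriv ?F) + c * fps_deriv ?F + fps_const (1/4) * ?F = 0"
    using Phi_fps_ode[of 0] by (simp add: c_def numeral_2_eq_2)
  have ne: "?F \<noteq> 0"
    using Phi_fps_nth_0 by force
  have "fps_deriv (V_fps * ?F) = - fps_deriv (fps_deriv ?F)"
    unfolding V_fps_mult by simp
  then have 1: "fps_deriv V_fps * ?F = - fps_deriv (fps_deriv ?F) - V_fps * fps_deriv ?F"
    by (simp add: algebra_simps)
  have 2: "fps_deriv ?F = - (V_fps * ?F)"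
    using V_fps_mult by simp
  have 3: "fps_X * fps_deriv (fps_deriv ?F) = - c * fps_deriv ?F - fps_const (1/4) * ?F"
    using ode by (simp add: add_eq_0_iff2 add.assoc)
  have "fps_X * fps_deriv V_fps * ?F = - (fps_X * fps_deriv (fps_deriv ?F)) - fps_X * V_fps * fps_deriv ?F"
    unfolding mult.assoc 1 by (simp only: right_diff_distrib mult_minus_right)
  also have "\<dots> = (fps_const (1/4) - c * V_fps + fps_X * V_fps\<^sup>2) * ?F"
    unfolding 3 unfolding 2 power2_eq_square
    by (simp only: algebra_simps mult_minus_left mult_minus_right minus_minus) simp
  finally show ?thesis
    using ne by (simp add: c_def)
qed

lemma V_fps_nth_rec:
  "(of_nat k + of_real (\<nu> + 1)) * fps_nth V_fps k
     = (if k = 0 then 1/4 else \<Sum>i<k. fps_nth V_fps i * fps_nth V_fps (k - 1 - i))"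
proof -
  have "fps_nth (fps_X * fps_deriv V_fps) k =
    fps_nth (fps_const (1/4) - fps_const (of_real (\<nu> + 1)) * V_fps + fps_X * V_fps\<^sup>2) k"
    by (simp only: V_fps_riccati)
  moreover have "fps_nth (V_fps\<^sup>2) m = (\<Sum>i\<le>m. fps_nth V_fps i * fps_nth V_fps (m - i))" for m
    by (simp add: power2_eq_square fps_mult_nth atLeast0AtMost)
  ultimately show ?thesis
    by (cases k) (auto simp: algebra_simps lessThan_Suc_atMost)
qed

text \<open>The Rayleigh sums \<open>\<Sum>\<^sub>n j\<^sub>\<nu>\<^sub>,\<^sub>n\<^bsup>-2(k+1)\<^esup>\<close>, accessed through a recursion instead of the zeros.\<close>

definition rayleigh :: "nat \<Rightarrow> real" where
  "rayleigh k = Re (fps_nth V_fps k)"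

text \<open>\<open>A0\<close> is the constant coefficient of \<open>V\<close>. The ratio
  \<open>rho\<close> is chosen so that \<open>(k + \<nu> + 1) * rho \<le> k * A0\<close> for all
  \<open>k \<ge> 1\<close>, which is what the induction below needs.\<close>

definition A0 :: real where "A0 = 1 / (4 * (\<nu> + 1))"
definition rho :: real where "rho = A0 / (\<nu> + 2)"

lemma A0_pos: "A0 > 0" and rho_pos: "rho > 0"
  using order_gt by (auto simp: A0_def rho_def)

text \<open>The recursion makes each later coefficient a sum of products of earlier ones over a
  positive number. This gives reality, positivity and at least geometric growth together.\<close>

lemma V_fps_nth_aux: "fps_nth V_fps k = of_real (rayleigh k) \<and> rayleigh k \<ge> A0 * rho ^ k"
proof (induction k rule: less_induct)
  case (less k)
  show ?case
  proof (cases k)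
    case 0
    have "of_real (4 * (\<nu> + 1)) * fps_nth V_fps 0 = 1"
      using V_fps_nth_rec[of 0] by (simp add: algebra_simps)
    then have "fps_nth V_fps 0 = of_real A0"
      unfolding A0_def of_real_divide of_real_1
      by (metis mult_zero_left nonzero_mult_div_cancel_left zero_neq_one)
    then show ?thesis
      using 0 by (simp add: rayleigh_def)
  next
    case (Suc m)
    define S where "S = (\<Sum>i<k. rayleigh i * rayleigh (k - 1 - i))"
    have "(of_nat k + of_real (\<nu> + 1)) * fps_nth V_fps k = of_real S"
      using less Suc unfolding V_fps_nth_rec S_def by simp
    then have "of_real (real k + \<nu> + 1) * fps_nth V_fps k = of_real S"
      by (simp add: algebra_simps)
    moreover have pos: "real k + \<nu> + 1 > 0"
      using order_gt by linarith
    ultimately have eq: "fps_nth V_fps k = of_real (S / (real k + \<nu> + 1))"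
      by (metis less_irrefl nonzero_mult_div_cancel_left of_real_divide of_real_eq_0_iff)
    then have ray: "rayleigh k = S / (real k + \<nu> + 1)"
      by (simp add: rayleigh_def)
    \<comment> \<open>Each of the \<open>k\<close> products is at least
      \<open>A0\<^sup>2 * rho ^ m\<close>, because the two indices add up to
      \<open>k - 1 = m\<close>.\<close>
    have "(\<Sum>i<k. A0\<^sup>2 * rho ^ m) \<le> S"
      unfolding S_def
    proof (rule sum_mono)
      fix i assume i: "i \<in> {..<k}"
      then have "(A0 * rho ^ i) * (A0 * rho ^ (k - 1 - i)) \<le> rayleigh i * rayleigh (k - 1 - i)"
        using less[of i] less[of "k - 1 - i"] A0_pos rho_pos Suc
        by (intro mult_mono) (auto intro: order_trans[rotated])
      moreover have "rho ^ i * rho ^ (k - 1 - i) = rho ^ m"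
        using i Suc by (simp flip: power_add)
      ultimately show "A0\<^sup>2 * rho ^ m \<le> rayleigh i * rayleigh (k - 1 - i)"
        by (simp add: power2_eq_square algebra_simps)
    qed
    then have S: "real k * (A0\<^sup>2 * rho ^ m) \<le> S"
      by simp
    have "(real k + \<nu> + 1) * (A0 * rho ^ k) = A0 * rho ^ m * ((real k + \<nu> + 1) * rho)"
      using Suc by (simp add: algebra_simps)
    also have "(real k + \<nu> + 1) * rho \<le> real k * A0"
    proof -
      have "0 \<le> real m * (\<nu> + 1)"
        using order_gt by simp
      then have "real k + \<nu> + 1 \<le> real k * (\<nu> + 2)"
        using Suc by (simp add: algebra_simps)
      then have "(real k + \<nu> + 1) * A0 \<le> real k * (\<nu> + 2) * A0"
        using A0_pos by (intro mult_right_mono) auto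
      then show ?thesis
        using order_gt by (simp add: rho_def field_simps)
    qed
    then have "A0 * rho ^ m * ((real k + \<nu> + 1) * rho) \<le> A0 * rho ^ m * (real k * A0)"
      using A0_pos rho_pos by (intro mult_left_mono) auto
    also have "\<dots> = real k * (A0\<^sup>2 * rho ^ m)"
      by (simp add: power2_eq_square)
    also note S
    finally have "A0 * rho ^ k \<le> rayleigh k"
      using pos by (simp add: ray field_simps)
    then show ?thesis
      using eq ray by simp
  qed
qed

lemma V_fps_nth: "fps_nth V_fps k = of_real (rayleigh k)"
  and rayleigh_ge: "rayleigh k \<ge> A0 * rho ^ k"
  using V_fps_nth_aux by auto

lemma rayleigh_pos: "rayleigh k > 0"
  using rayleigh_ge[of k] A0_pos rho_pos by (smt (verit) mult_pos_pos zero_less_power)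

definition V :: "complex \<Rightarrow> complex" where
  "V z = - Phi' z / Phi z"

lemma V_has_fps_expansion: "V has_fps_expansion V_fps"
proof -
  have "Phi has_fps_expansion Phi_fps" "Phi' has_fps_expansion fps_deriv Phi_fps"
    unfolding Phi_def Phi'_def by (rule eval_fps_has_fps_expansion, simp)+
  then have "(\<lambda>z. - Phi' z * inverse (Phi z)) has_fps_expansion V_fps"
    unfolding V_fps_def by (intro fps_expansion_intros) auto
  then show ?thesis
    by (simp add: V_def[abs_def] divide_inverse)
qed

text \<open>The radius is left free because the lemma is first applied under the assumption that
  \<open>Phi\<close> has no zero at all.\<close>

lemma V_sums:
  assumes "\<And>w. norm w < r \<Longrightarrow> Phi w \<noteq> 0" and "norm z < r"
  shows "(\<lambda>k. of_real (rayleigh k) * z ^ k) sums V z"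
proof -
  have "V holomorphic_on eball 0 (ereal r)"
    unfolding V_def using assms by (intro holomorphic_intros holomorphic_Phi holomorphic_Phi') auto
  then show ?thesis
    using has_fps_expansion_imp_sums_complex[OF V_has_fps_expansion, of "ereal r" z] assms
    by (simp add: V_fps_nth)
qed

text \<open>Without zeros \<open>V\<close> would be entire, but at \<open>1 / rho\<close> the terms
  of its Taylor series stay at or above \<open>A0\<close>.\<close>

lemma Phi_has_zero: "\<exists>z. Phi z = 0"
proof (rule ccontr)
  assume "\<not> ?thesis"
  then have "(\<lambda>k. of_real (rayleigh k) * (of_real (1 / rho)) ^ k) sums V (of_real (1 / rho))"
    using rho_pos by (intro V_sums[of "1 / rho + 1"]) (auto simp: norm_divide)
  then have "(\<lambda>k. complex_of_real (rayleigh k) * (of_real (1 / rho)) ^ k) \<longlonglongrightarrow> 0"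
    by (intro summable_LIMSEQ_zero) (auto simp: sums_iff)
  then have "(\<lambda>k. complex_of_real (rayleigh k / rho ^ k)) \<longlonglongrightarrow> 0"
    by (simp add: field_simps)
  then have "(\<lambda>k. rayleigh k / rho ^ k) \<longlonglongrightarrow> 0"
    by (metis of_real_0 tendsto_of_real_iff)
  moreover have "A0 \<le> rayleigh k / rho ^ k" for k
    using rayleigh_ge[of k] rho_pos by (simp add: field_simps)
  ultimately have "A0 \<le> 0"
    by (intro LIMSEQ_le_const) auto
  then show False
    using A0_pos by simp
qed

section \<open>The zero of least modulus and bounds for the logarithmic derivative\<close>

definition R :: real where
  "R = infdist 0 {z. Phi z = 0}"

lemma Phi_nonzero: "norm z < R \<Longrightarrow> Phi z \<noteq> 0"
  using infdist_le[of z "{z. Phi z = 0}" 0] by (auto simp: R_def)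

text \<open>The distance to an empty set is 0 by convention, so \<open>Phi_has_zero\<close> is what
  makes \<open>R\<close> the least modulus of a zero.\<close>

lemma Phi_zero_of_norm_R: obtains z where "Phi z = 0" "norm z = R"
proof -
  have "closed {z. Phi z = 0}"
    using continuous_on_Phi by (intro closed_Collect_eq) auto
  then obtain z where "z \<in> {z. Phi z = 0}" "infdist 0 {z. Phi z = 0} = dist 0 z"
    using infdist_attains_inf Phi_has_zero by blast
  then show thesis
    by (intro that[of z]) (simp_all add: R_def)
qed

lemma R_pos: "R > 0"
proof -
  obtain z where "Phi z = 0" "norm z = R"
    by (rule Phi_zero_of_norm_R)
  then have "z \<noteq> 0"
    by auto
  then show ?thesis
    using \<open>norm z = R\<close> by (simp flip: \<open>norm z = R\<close>)
qed

lemma V_of_real: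
  assumes "\<bar>t\<bar> < R"
  shows "(\<lambda>k. rayleigh k * t ^ k) sums Re (V (of_real t))" and "V (of_real t) = of_real (Re (V (of_real t)))"
proof -
  have *: "(\<lambda>k. complex_of_real (rayleigh k * t ^ k)) sums V (of_real t)"
    using V_sums[of R "of_real t"] assms Phi_nonzero by simp
  show "(\<lambda>k. rayleigh k * t ^ k) sums Re (V (of_real t))"
    using sums_Re[OF *] by simp
  have "(\<lambda>k. 0) sums Im (V (of_real t))"
    using sums_Im[OF *] by simp
  then have "Im (V (of_real t)) = 0"
    using sums_unique2 sums_zero by blast
  then show "V (of_real t) = of_real (Re (V (of_real t)))"
    by (simp add: complex_eq_iff)
qed

text \<open>Triangle inequality for a power series with positive coefficients.\<close>

lemma norm_V_le:
  assumes "norm w < R"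
  shows "norm (V w) \<le> Re (V (of_real (norm w)))"
proof -
  have 1: "(\<lambda>k. of_real (rayleigh k) * w ^ k) sums V w"
    using V_sums[of R w] assms Phi_nonzero by simp
  have 2: "(\<lambda>k. rayleigh k * norm w ^ k) sums Re (V (of_real (norm w)))"
    using V_of_real[of "norm w"] assms by simp
  have "norm (\<Sum>k. of_real (rayleigh k) * w ^ k) \<le> (\<Sum>k. rayleigh k * norm w ^ k)"
    using 2 rayleigh_pos[THEN less_imp_le]
    by (intro norm_suminf_le) (auto simp: norm_mult norm_power sums_iff)
  then show ?thesis
    using 1 2 by (simp add: sums_iff)
qed

lemma V_of_real_mono:
  assumes "0 \<le> s" "s \<le> t" "t < R"
  shows "Re (V (of_real s)) \<le> Re (V (of_real t))"
  using V_of_real(1)[of s] V_of_real(1)[of t] assms rayleigh_pos[THEN less_imp_le]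
  by (intro sums_le[OF _ V_of_real(1) V_of_real(1)] mult_left_mono power_mono) auto

lemma V_0 [simp]: "V 0 = of_real (rayleigh 0)"
  using V_sums[of R 0] R_pos Phi_nonzero by (simp add: powser_sums_zero_iff)

lemma V_of_real_pos: "0 \<le> t \<Longrightarrow> t < R \<Longrightarrow> 0 < Re (V (of_real t))"
  using V_of_real_mono[of 0 t] rayleigh_pos[of 0] by simp

text \<open>
  If \<open>Phi\<close> did not vanish at \<open>R\<close>, then \<open>V\<close> would be bounded on \<open>[0, R)\<close>, hence in the whole
  disc, and every zero of modulus \<open>R\<close> would be a double zero.
\<close>

lemma Phi_R: "Phi (of_real R) = 0"
proof (rule ccontr)
  assume R: "Phi (of_real R) \<noteq> 0"
  have "Phi (of_real t) \<noteq> 0" if "t \<in> {0..R}" for t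
    using R Phi_nonzero[of "of_real t"] that by (cases "t = R") auto
  then have "continuous_on {0..R} (\<lambda>t. Re (V (of_real t)))"
    unfolding V_def
    by (intro continuous_intros continuous_on_compose2[OF continuous_on_Phi]
        continuous_on_compose2[OF continuous_on_Phi']) auto
  then obtain B where B: "\<And>t. t \<in> {0..R} \<Longrightarrow> Re (V (of_real t)) \<le> B"
    using continuous_attains_sup[of "{0..R}" "\<lambda>t. Re (V (of_real t))"] R_pos by fastforce
  obtain w where w: "Phi w = 0" "norm w = R"
    by (rule Phi_zero_of_norm_R)
  \<comment> \<open>The bound on \<open>V\<close> is cleared of its denominator so that it survives
    the radial limit at the zero \<open>w\<close>.\<close>
  have le: "norm (Phi' (of_real s * w)) \<le> B * norm (Phi (of_real s * w))" if s: "0 < s" "s < 1" for s :: real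
  proof -
    let ?z = "of_real s * w"
    have z: "norm ?z < R"
      using s w R_pos by (simp add: norm_mult)
    then have "norm (V ?z) \<le> B"
      using norm_V_le[of ?z] B[of "norm ?z"] by auto
    then show ?thesis
      using Phi_nonzero[OF z] by (simp add: V_def norm_divide divide_simps)
  qed
  have lim: "((\<lambda>s::real. of_real s * w) \<longlongrightarrow> w) (at_left 1)"
    by (auto intro!: tendsto_eq_intros)
  have *: "isCont Phi w" "isCont Phi' w"
    using continuous_on_Phi[of UNIV] continuous_on_Phi'[of UNIV] by (auto simp: continuous_on_eq_continuous_at)
  have "norm (Phi' w) \<le> B * norm (Phi w)"
  proof (rule tendsto_le)
    show "((\<lambda>s::real. norm (Phi' (of_real s * w))) \<longlongrightarrow> norm (Phi' w)) (at_left 1)"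
      "((\<lambda>s::real. B * norm (Phi (of_real s * w))) \<longlongrightarrow> B * norm (Phi w)) (at_left 1)"
      by (intro tendsto_intros isCont_tendsto_compose[OF _ lim] *)+
    show "\<forall>\<^sub>F s in at_left 1. norm (Phi' (of_real s * w)) \<le> B * norm (Phi (of_real s * w))"
      using eventually_at_left_real[of 0 1] by (rule eventually_mono) (auto intro!: le)
  qed auto
  then show False
    using w Phi_zero_simple by simp
qed

section \<open>Growth of the starlikeness function up to its first pole\<close>

definition Q :: "complex \<Rightarrow> complex" where
  "Q z = z * V z"

lemma Q_0 [simp]: "Q 0 = 0"
  by (simp add: Q_def)

lemma Q_of_real:
  assumes "\<bar>t\<bar> < R"
  shows "Q (of_real t) = of_real (t * Re (V (of_real t)))"
  unfolding Q_def by (subst V_of_real(2)[OF assms]) simp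

lemma Re_Q_of_real: "Re (Q (of_real t)) = t * Re (V (of_real t))"
  by (simp add: Q_def)

lemma norm_Q_le: "norm w < R \<Longrightarrow> norm (Q w) \<le> Re (Q (of_real (norm w)))"
  unfolding Re_Q_of_real by (simp add: Q_def norm_mult norm_V_le mult_left_mono)

lemma Q_of_real_strict_mono:
  assumes "0 \<le> s" "s < t" "t < R"
  shows "Re (Q (of_real s)) < Re (Q (of_real t))"
proof -
  have "s * Re (V (of_real s)) \<le> s * Re (V (of_real t))"
    using assms V_of_real_mono by (intro mult_left_mono) auto
  also have "\<dots> < t * Re (V (of_real t))"
    using assms V_of_real_pos[of t] by (intro mult_strict_right_mono) auto
  finally show ?thesis
    by (simp only: Re_Q_of_real)
qed

text \<open>Since \<open>R\<close> is a simple zero of \<open>Phi\<close>, \<open>V\<close> behaves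
  like \<open>1 / (R - t)\<close> there, and \<open>Q\<close> like
  \<open>R / (R - t)\<close>.\<close>

lemma Q_residue: "((\<lambda>t. (R - t) * Re (Q (of_real t))) \<longlongrightarrow> R) (at_left R)"
proof -
  let ?R = "complex_of_real R"
  have "((\<lambda>z. (Phi z - Phi ?R) / (z - ?R)) \<longlongrightarrow> Phi' ?R) (at ?R)"
    using has_derivative_Phi[of ?R UNIV] by (simp add: has_field_derivative_iff)
  moreover have lim: "(of_real \<longlongrightarrow> ?R) (at_left R)"
    by (intro tendsto_intros)
  then have "filterlim of_real (at ?R) (at_left R)"
    by (auto simp: filterlim_at eventually_at_filter)
  ultimately have "((\<lambda>t. (Phi (of_real t) - Phi ?R) / (of_real t - ?R)) \<longlongrightarrow> Phi' ?R) (at_left R)"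
    by (rule filterlim_compose)
  moreover have "isCont Phi' ?R"
    using continuous_on_Phi'[of UNIV] by (auto simp: continuous_on_eq_continuous_at)
  then have "((\<lambda>t. Phi' (of_real t)) \<longlongrightarrow> Phi' ?R) (at_left R)"
    by (rule isCont_tendsto_compose[OF _ lim])
  ultimately have "((\<lambda>t. of_real t * Phi' (of_real t) / ((Phi (of_real t) - Phi ?R) / (of_real t - ?R)))
      \<longlongrightarrow> ?R * Phi' ?R / Phi' ?R) (at_left R)"
    by (intro tendsto_intros lim Phi_zero_simple Phi_R)
  then have "((\<lambda>t. of_real (R - t) * Q (of_real t)) \<longlongrightarrow> ?R * Phi' ?R / Phi' ?R) (at_left R)"
    by (rule Lim_transform_eventually)
      (auto intro!: eventually_mono[OF eventually_at_left_real[OF R_pos]]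
        simp: Q_def V_def Phi_R Phi_nonzero divide_simps algebra_simps)
  from tendsto_Re[OF this] show ?thesis
    using Phi_zero_simple[OF Phi_R] by simp
qed

lemma holomorphic_Q: "Q holomorphic_on ball 0 R"
  unfolding Q_def V_def
  by (intro holomorphic_intros holomorphic_Phi holomorphic_Phi') (auto simp: Phi_nonzero)

text \<open>Intermediate value theorem: \<open>Q\<close> starts at 0 and cannot stay below
  \<open>c\<close>, since then \<open>(R - t) * Q t\<close> would have a limit of at most 0 instead
  of \<open>R\<close>.\<close>

lemma Q_attains:
  assumes "c > 0"
  obtains t where "0 < t" "t < R" "Re (Q (of_real t)) = c"
proof -
  have "\<exists>s. 0 < s \<and> s < R \<and> c < Re (Q (of_real s))"
  proof (rule ccontr)
    assume *: "\<not> ?thesis"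
    have "R \<le> (R - R) * c"
    proof (rule tendsto_le[OF _ _ Q_residue])
      show "((\<lambda>t. (R - t) * c) \<longlongrightarrow> (R - R) * c) (at_left R)"
        by (intro tendsto_intros)
      show "\<forall>\<^sub>F t in at_left R. (R - t) * Re (Q (of_real t)) \<le> (R - t) * c"
        by (rule eventually_mono[OF eventually_at_left_real[OF R_pos]])
          (use * in \<open>auto simp: not_less not_le intro!: mult_left_mono\<close>, meson not_le)
    qed auto
    then show False
      using R_pos by simp
  qed
  then obtain s where s: "0 < s" "s < R" "c < Re (Q (of_real s))"
    by blast
  have "continuous_on {0..s} (\<lambda>t. Re (Q (of_real t)))"
    using s by (intro continuous_intros continuous_on_compose2[OF holomorphic_on_imp_continuous_on[OF holomorphic_Q]]) auto
  then obtain t where t: "0 \<le> t" "t \<le> s" "Re (Q (of_real t)) = c"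
    using IVT'[of "\<lambda>t. Re (Q (of_real t))" 0 c s] s assms by auto
  with assms have "t \<noteq> 0"
    by auto
  then show thesis
    using that[of t] t s by simp
qed

lemma Re_Q_less:
  assumes "t < R" "norm w < t"
  shows "Re (Q w) < Re (Q (of_real t))"
  using complex_Re_le_cmod[of "Q w"] norm_Q_le[of w] Q_of_real_strict_mono[of "norm w" t] assms
  by simp

text \<open>The Riccati equation as an identity between function values, valid at every point where
  \<open>Phi\<close> does not vanish and not only inside the disc of convergence.\<close>

lemma Q_riccati:
  assumes "Phi z \<noteq> 0"
  obtains D where "(Q has_field_derivative D) (at z)" "z * D = (Q z)\<^sup>2 - of_real \<nu> * Q z + z / 4"
proof -
  have "(Phi' has_field_derivative deriv Phi' z) (at z)"
    using holomorphic_Phi'[of UNIV] by (auto intro: holomorphic_derivI)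
  moreover have "Phi' = deriv Phi"
    using deriv_Phi by auto
  ultimately have Phi'': "(Phi' has_field_derivative (deriv ^^ 2) Phi z) (at z)"
    by (simp add: numeral_2_eq_2)
  define D2 where "D2 = (deriv ^^ 2) Phi z"
  define D where "D = V z + z * ((- D2 * Phi z - (- Phi' z) * Phi' z) / (Phi z * Phi z))"
  have ode: "z * D2 = - (of_real \<nu> + 1) * Phi' z - Phi z / 4"
  proof -
    have "z * D2 + (of_real \<nu> + 1) * Phi' z + Phi z / 4 = 0"
      using Phi_ode[of z 0] by (simp add: D2_def deriv_Phi numeral_2_eq_2)
    then have "z * D2 = z * D2 - (z * D2 + (of_real \<nu> + 1) * Phi' z + Phi z / 4)"
      by simp
    also have "\<dots> = - (of_real \<nu> + 1) * Phi' z - Phi z / 4"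
      by (simp add: algebra_simps)
    finally show ?thesis .
  qed
  show thesis
  proof
    show "(Q has_field_derivative D) (at z)"
      unfolding Q_def V_def D_def using assms
      by (auto intro!: derivative_eq_intros has_derivative_Phi Phi'' simp: D2_def divide_simps) (simp add: algebra_simps)
    have "z * D = z * V z - z * (z * D2) / Phi z + (z * V z)\<^sup>2"
      using assms by (simp add: D_def V_def field_simps power2_eq_square)
    also have "\<dots> = (Q z)\<^sup>2 - of_real \<nu> * Q z + z / 4"
      unfolding ode using assms by (simp add: Q_def V_def field_simps power2_eq_square)
    finally show "z * D = (Q z)\<^sup>2 - of_real \<nu> * Q z + z / 4" .
  qed
qed

subsection \<open>The Herglotz argument for negative order\<close>

text \<open>The shift completes the square in the Riccati equation. The starlike quotient of
  \<open>Bessel_f\<close> is \<open>- (2 / \<nu>) * P (z\<^sup>2)\<close>.\<close>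

definition P :: "complex \<Rightarrow> complex" where
  "P z = Q z - of_real (\<nu> / 2)"

lemma holomorphic_P: "P holomorphic_on ball 0 R"
  unfolding P_def by (intro holomorphic_intros holomorphic_Q)

lemma continuous_on_P: "S \<subseteq> ball 0 R \<Longrightarrow> continuous_on S P"
  using holomorphic_P holomorphic_on_imp_continuous_on holomorphic_on_subset by blast

lemma P_riccati:
  assumes "norm z < R"
  obtains D where "(P has_field_derivative D) (at z)" "z * D = (P z)\<^sup>2 + (z - of_real (\<nu>\<^sup>2)) / 4"
proof -
  obtain D where D: "(Q has_field_derivative D) (at z)" "z * D = (Q z)\<^sup>2 - of_real \<nu> * Q z + z / 4"
    using Q_riccati Phi_nonzero assms by blast
  show thesis
  proof
    show "(P has_field_derivative D) (at z)"
      unfolding P_def using D(1) by (auto intro!: derivative_eq_intros)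
    show "z * D = (P z)\<^sup>2 + (z - of_real (\<nu>\<^sup>2)) / 4"
      unfolding D(2) by (simp add: P_def field_simps power2_eq_square)
  qed
qed

lemma P_of_real: "\<bar>t\<bar> < R \<Longrightarrow> P (of_real t) = of_real (Re (P (of_real t)))"
  by (simp add: P_def Q_of_real Re_Q_of_real)

lemma Re_P_of_real_nonneg:
  assumes "0 \<le> t" "t < R"
  shows "Re (P (of_real t)) \<ge> - \<nu> / 2"
  using V_of_real_pos[of t] assms by (simp add: P_def Re_Q_of_real)

text \<open>
  At a point of smallest modulus where the real part of \<open>P\<close> vanishes, that real part is minimal
  on the circle, so \<open>z P'(z)\<close> is real; the Riccati equation then forces \<open>z\<close> itself to be real.
\<close>

lemma Re_P_pos:
  assumes "\<nu> < 0" "r \<le> R"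
    and neg: "\<And>t. 0 < t \<Longrightarrow> t < r \<Longrightarrow> Re (P (of_real (- t))) > 0"
    and "norm z < r"
  shows "Re (P z) > 0"
proof (rule ccontr)
  assume z: "\<not> ?thesis"
  \<comment> \<open>The bad points of modulus at most \<open>norm z\<close>; one nearest to the
    origin is the first point where positivity fails.\<close>
  define K where "K = cball 0 (norm z) \<inter> (\<lambda>w. Re (P w)) -` {..0}"
  have sub: "cball 0 (norm z) \<subseteq> ball (0::complex) R"
    using assms by auto
  have "closed K"
    unfolding K_def
    by (intro continuous_closed_preimage continuous_intros continuous_on_P sub) auto
  moreover have "z \<in> K"
    using z by (auto simp: K_def)
  then have "K \<noteq> {}"
    by blast
  ultimately obtain w where w: "w \<in> K" "\<And>y. y \<in> K \<Longrightarrow> norm w \<le> norm y"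
    using distance_attains_inf[of K 0] unfolding dist_0_norm by blast
  have wz: "norm w \<le> norm z" and Re_w: "Re (P w) \<le> 0"
    using w by (auto simp: K_def)
  have wR: "norm w < R"
    using wz assms by auto
  have inside: "Re (P y) > 0" if "norm y < norm w" for y
    using w(2)[of y] that wz by (force simp: K_def)
  have w0: "w \<noteq> 0"
    using Re_w assms by (auto simp: P_def)
  \<comment> \<open>Radial limit of the positive values inside the circle.\<close>
  have bdry: "Re (P y) \<ge> 0" if y: "norm y = norm w" for y
  proof -
    have "isCont P y"
      using continuous_on_P[OF order_refl] wR y by (simp add: continuous_on_eq_continuous_at)
    moreover have "((\<lambda>s::real. of_real s * y) \<longlongrightarrow> y) (at_left 1)"
      by (auto intro!: tendsto_eq_intros)
    ultimately have "((\<lambda>s::real. P (of_real s * y)) \<longlongrightarrow> P y) (at_left 1)"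
      by (rule isCont_tendsto_compose)
    then have "((\<lambda>s::real. Re (P (of_real s * y))) \<longlongrightarrow> Re (P y)) (at_left 1)"
      by (rule tendsto_Re)
    moreover have "\<forall>\<^sub>F s in at_left 1. 0 \<le> Re (P (of_real s * y))"
      using eventually_at_left_real[of 0 1]
      by (rule eventually_mono) (use w0 y in \<open>auto intro!: less_imp_le inside simp: norm_mult\<close>)
    ultimately show ?thesis
      by (intro tendsto_lowerbound) auto
  qed
  have Re_w0: "Re (P w) = 0"
    using bdry[of w] Re_w by simp
  obtain D where D: "(P has_field_derivative D) (at w)" "w * D = (P w)\<^sup>2 + (w - of_real (\<nu>\<^sup>2)) / 4"
    using P_riccati[OF wR] .
  \<comment> \<open>The circle through \<open>w\<close> is parametrized by the angle; the minimum of
    \<open>Re P\<close> at angle 0 gives a vanishing derivative.\<close>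
  have "((\<lambda>z. w * exp (\<i> * z)) has_field_derivative (w * \<i>)) (at (of_real 0))"
    by (auto intro!: derivative_eq_intros)
  then have "((\<lambda>x. w * cis x) has_vector_derivative (w * \<i>)) (at 0)"
    unfolding cis_conv_exp by (rule has_vector_derivative_real_field)
  then have "(P \<circ> (\<lambda>x. w * cis x) has_vector_derivative (w * \<i>) * D) (at 0)"
    by (rule field_vector_diff_chain_at) (use D(1) in simp)
  then have "((\<lambda>x. Re (P (w * cis x))) has_vector_derivative Re (w * \<i> * D)) (at 0)"
    unfolding o_def by (rule bounded_linear.has_vector_derivative[OF bounded_linear_Re])
  then have "((\<lambda>x. Re (P (w * cis x))) has_real_derivative Re (w * \<i> * D)) (at 0)"
    by (simp add: has_real_derivative_iff_has_vector_derivative)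
  then have "Re (w * \<i> * D) = 0"
    by (rule DERIV_local_min[of _ _ _ 1]) (auto simp: Re_w0 norm_mult intro!: bdry)
  then have "Im (w * D) = 0"
    by (simp add: algebra_simps)
  \<comment> \<open>\<open>P w\<close> is purely imaginary, so its square is real and the imaginary
    part of the right-hand side is \<open>Im w / 4\<close>.\<close>
  then have "Im w = 0"
    unfolding D(2) using Re_w0 by (simp add: power2_eq_square)
  then have w_real: "w = of_real (Re w)"
    by (simp add: complex_eq_iff)
  show False
  proof (cases "Re w \<ge> 0")
    case True
    then have "norm w = Re w"
      by (subst w_real) simp
    then show False
      using Re_P_of_real_nonneg[of "Re w"] Re_w True \<open>\<nu> < 0\<close> wR
      by (simp flip: w_real)
  next
    case False
    have "norm w = - Re w"
      using False by (subst w_real) simp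
    then show False
      using neg[of "- Re w"] False Re_w wz \<open>norm z < r\<close> by (simp flip: w_real)
  qed
qed

text \<open>
  If \<open>P\<close> had positive real part in the whole disc, the Schwarz lemma (Harnack's inequality) would
  give \<open>P(Rs) (1 - s) \<le> - \<nu>\<close> for \<open>0 < s < 1\<close>, but the left side tends to 1, by the
  simple pole of \<open>P\<close> at \<open>R\<close>.
\<close>

lemma P_nonpos_somewhere:
  assumes "\<nu> < 0"
  obtains t where "0 < t" "t < R" "Re (P (of_real (- t))) \<le> 0"
proof (rule ccontr)
  assume *: "\<not> thesis"
  have "Re (P (of_real (- t))) > 0" if "0 < t" "t < R" for t
    using * that \<open>\<And>t. 0 < t \<Longrightarrow> t < R \<Longrightarrow> Re (P (of_real (- t))) \<le> 0 \<Longrightarrow> thesis\<close> not_le by blast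
  then have pos: "Re (P z) > 0" if "norm z < R" for z
    using Re_P_pos[OF assms order_refl _ that] by blast
  define a where "a = - \<nu> / 2"
  have a: "a > 0"
    using assms by (simp add: a_def)
  \<comment> \<open>Cayley transform from the right half-plane to the unit disc, sending the value
    \<open>P 0 = a\<close> to 0.\<close>
  define f where "f = (\<lambda>z. (P (of_real R * z) - of_real a) / (P (of_real R * z) + of_real a))"
  have disc: "norm (of_real R * z) < R" if "norm z < 1" for z :: complex
    using that R_pos by (simp add: norm_mult)
  have nz: "P (of_real R * z) + of_real a \<noteq> 0" if "norm z < 1" for z
    using pos[OF disc[OF that]] a by (auto simp: complex_eq_iff)
  have "(\<lambda>z. P (of_real R * z)) holomorphic_on ball 0 1"
    by (rule holomorphic_on_compose_gen[OF _ holomorphic_P, unfolded o_def])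
      (auto intro!: holomorphic_intros disc)
  then have "f holomorphic_on ball 0 1"
    unfolding f_def using nz by (intro holomorphic_intros) auto
  moreover have "f 0 = 0"
    by (simp add: f_def P_def a_def)
  moreover have "norm (f z) < 1" if "norm z < 1" for z
  proof -
    have "(norm (P (of_real R * z) - of_real a))\<^sup>2 < (norm (P (of_real R * z) + of_real a))\<^sup>2"
      using pos[OF disc[OF that]] a
      unfolding cmod_power2 by (simp add: power2_eq_square algebra_simps)
    then have "norm (P (of_real R * z) - of_real a) < norm (P (of_real R * z) + of_real a)"
      by (rule power_less_imp_less_base) simp
    then show ?thesis
      using nz[OF that] by (simp add: f_def norm_divide)
  qed
  ultimately have schwarz: "norm (f z) \<le> norm z" if "norm z < 1" for z
    using Schwarz_Lemma(1)[of f] that by blast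
  have le: "(R - t) * Re (Q (of_real t)) \<le> a * (2 * t)" if t: "0 < t" "t < R" for t
  proof -
    define p where "p = Re (P (of_real t))"
    have p: "P (of_real t) = of_real p"
      using P_of_real[of t] t by (simp add: p_def)
    have "p \<ge> a"
      using Re_P_of_real_nonneg[of t] t by (simp add: p_def a_def)
    have "f (of_real (t / R)) = of_real ((p - a) / (p + a))"
      using R_pos by (simp add: f_def p)
    then have "norm (complex_of_real ((p - a) / (p + a))) \<le> norm (complex_of_real (t / R))"
      using schwarz[of "of_real (t / R)"] t by (simp only: norm_of_real) simp
    then have "(p - a) / (p + a) \<le> t / R"
      using \<open>p \<ge> a\<close> a t by (simp only: norm_of_real) simp
    then have "(p - a) * R \<le> t * (p + a)"
      using \<open>p \<ge> a\<close> a R_pos by (simp add: field_simps)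
    then have "(R - t) * (p - a) \<le> a * (2 * t)"
      by (simp add: algebra_simps)
    moreover have "Re (Q (of_real t)) = p - a"
      by (simp add: p_def P_def a_def)
    ultimately show ?thesis
      by simp
  qed
  \<comment> \<open>Letting \<open>t\<close> tend to \<open>R\<close> gives
    \<open>R \<le> - \<nu> * R\<close>, which is impossible because
    \<open>- \<nu> < 1\<close>.\<close>
  have "R \<le> a * (2 * R)"
  proof (rule tendsto_le[OF _ _ Q_residue])
    show "((\<lambda>t. a * (2 * t)) \<longlongrightarrow> a * (2 * R)) (at_left R)"
      by (intro tendsto_intros)
    show "\<forall>\<^sub>F t in at_left R. (R - t) * Re (Q (of_real t)) \<le> a * (2 * t)"
      by (rule eventually_mono[OF eventually_at_left_real[OF R_pos]]) (auto intro!: le)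
  qed auto
  then show False
    using mult_strict_right_mono[OF order_gt R_pos] by (simp add: a_def)
qed

section \<open>Values on the negative real axis\<close>

definition b :: "nat \<Rightarrow> real" where
  "b n = 1 / (4 ^ n * fact n * pochhammer (\<nu> + 1) n)"

lemma b_pos: "b n > 0"
  using order_gt by (auto simp: b_def intro!: divide_pos_pos mult_pos_pos pochhammer_pos)

lemma Phi_fps_nth: "fps_nth Phi_fps n = of_real ((-1) ^ n * b n)"
  by (simp add: Phi_fps_def b_def pochhammer_of_real [symmetric])

lemma Phi_neg_sums: "(\<lambda>n. complex_of_real (b n * t ^ n)) sums Phi (of_real (- t))"
proof -
  have "fps_nth Phi_fps n * complex_of_real (- t) ^ n = complex_of_real (b n * t ^ n)" for n
  proof -
    have "fps_nth Phi_fps n * complex_of_real (- t) ^ n = complex_of_real (b n * ((-1) ^ n * (- t) ^ n))"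
      by (simp add: Phi_fps_nth)
    also have "(-1) ^ n * (- t) ^ n = t ^ n"
      by (simp flip: power_mult_distrib)
    finally show ?thesis .
  qed
  then show ?thesis
    using Phi_sums[of "of_real (- t)"] by (simp only:)
qed

lemma Phi_neg:
  assumes "0 \<le> t"
  shows "Phi (of_real (- t)) = of_real (Re (Phi (of_real (- t))))" "Re (Phi (of_real (- t))) > 0"
proof -
  have "(\<lambda>n. 0) sums Im (Phi (of_real (- t)))"
    using sums_Im[OF Phi_neg_sums[of t]] by simp
  then have "Im (Phi (of_real (- t))) = 0"
    using sums_unique2 sums_zero by blast
  then show "Phi (of_real (- t)) = of_real (Re (Phi (of_real (- t))))"
    by (simp add: complex_eq_iff)
  have s: "(\<lambda>n. b n * t ^ n) sums Re (Phi (of_real (- t)))"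
    using sums_Re[OF Phi_neg_sums[of t]] by simp
  have "(\<Sum>n\<in>{0::nat}. b n * t ^ n) \<le> (\<Sum>n. b n * t ^ n)"
    using s b_pos[THEN less_imp_le] assms by (intro sum_le_suminf) (auto simp: sums_iff)
  then show "Re (Phi (of_real (- t))) > 0"
    using s b_pos[of 0] by (simp add: sums_iff)
qed

text \<open>The numerator of \<open>-2 * P\<close> at \<open>-t\<close> over the denominator
  \<open>Phi\<close>. For \<open>t = x\<^sup>2\<close> it is also, up to the factor
  \<open>C x\<close>, the quantity \<open>x\<close> times the derivative of
  \<open>Bessel_I \<nu>\<close> at \<open>x\<close>.\<close>

definition E :: "real \<Rightarrow> complex" where
  "E t = of_real \<nu> * Phi (of_real (- t)) - 2 * of_real t * Phi' (of_real (- t))"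

text \<open>With \<open>z = -t\<close>, the operator \<nu> + 2 z d/dz multiplies the coefficient of
  index \<open>n\<close> by \<open>\<nu> + 2 * n\<close>.\<close>

lemma E_sums: "(\<lambda>n. complex_of_real ((\<nu> + 2 * real n) * b n * t ^ n)) sums E t"
proof -
  let ?z = "complex_of_real (- t)"
  let ?G = "fps_const (of_real \<nu>) * Phi_fps + fps_const 2 * (fps_X * fps_deriv Phi_fps)"
  have r1: "fps_conv_radius (fps_X * fps_deriv Phi_fps) = \<infinity>"
    using fps_conv_radius_mult[of fps_X "fps_deriv Phi_fps"] by simp
  have r2: "fps_conv_radius (fps_const 2 * (fps_X * fps_deriv Phi_fps)) = \<infinity>"
    using fps_conv_radius_mult[of "fps_const 2" "fps_X * fps_deriv Phi_fps"] by (simp add: r1)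
  have r3: "fps_conv_radius (fps_const (of_real \<nu>) * Phi_fps) = \<infinity>"
    using fps_conv_radius_mult[of "fps_const (of_real \<nu>)" Phi_fps] by simp
  have r4: "fps_conv_radius ?G = \<infinity>"
    using fps_conv_radius_add[of "fps_const (of_real \<nu>) * Phi_fps" "fps_const 2 * (fps_X * fps_deriv Phi_fps)"]
    by (simp add: r2 r3)
  have "(\<lambda>n. fps_nth ?G n * ?z ^ n) sums eval_fps ?G ?z"
    by (rule sums_eval_fps) (simp add: r4)
  also have "eval_fps ?G ?z = E t"
    by (simp add: eval_fps_add eval_fps_mult r1 r2 r3 E_def Phi_def Phi'_def)
  also have "(\<lambda>n. fps_nth ?G n * ?z ^ n) = (\<lambda>n. complex_of_real ((\<nu> + 2 * real n) * b n * t ^ n))"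
  proof
    fix n
    have "fps_nth ?G n = (of_real \<nu> + 2 * of_nat n) * fps_nth Phi_fps n"
      by (cases n) (simp_all add: algebra_simps)
    also have "\<dots> = of_real ((\<nu> + 2 * real n) * b n) * (-1) ^ n"
      by (simp add: Phi_fps_nth)
    finally show "fps_nth ?G n * ?z ^ n = complex_of_real ((\<nu> + 2 * real n) * b n * t ^ n)"
      by (simp add: power_minus[of "complex_of_real t"])
  qed
  finally show ?thesis .
qed

lemma Re_E_sums: "(\<lambda>n. (\<nu> + 2 * real n) * b n * t ^ n) sums Re (E t)"
  using sums_Re[OF E_sums[of t]] by simp

lemma E_real: "E t = of_real (Re (E t))"
proof -
  have "(\<lambda>n. 0) sums Im (E t)"
    using sums_Im[OF E_sums[of t]] by simp
  then have "Im (E t) = 0"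
    using sums_unique2 sums_zero by blast
  then show ?thesis
    by (simp add: complex_eq_iff)
qed

text \<open>Only the constant coefficient can fail to be positive, and it cancels in the difference:
  \<open>\<nu> + 2 * n > 0\<close> for \<open>n \<ge> 1\<close>.\<close>

lemma Re_E_strict_mono:
  assumes "0 \<le> s" "s < t"
  shows "Re (E s) < Re (E t)"
proof -
  let ?d = "\<lambda>n. (\<nu> + 2 * real n) * b n * t ^ n - (\<nu> + 2 * real n) * b n * s ^ n"
  have d: "?d sums (Re (E t) - Re (E s))"
    by (intro sums_diff Re_E_sums)
  have pos: "?d n > 0" if "n > 0" for n
  proof -
    have "s ^ n < t ^ n"
      using assms that by (intro power_strict_mono) auto
    moreover have "\<nu> + 2 * real n > 0"
      using order_gt that by linarith
    ultimately show ?thesis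
      using b_pos[of n] by simp
  qed
  have "0 < suminf ?d"
  proof (rule suminf_pos2[of _ 1])
    show "0 \<le> ?d n" for n
      using pos[of n] by (cases n) auto
  qed (use d pos[of 1] in \<open>auto simp: sums_iff\<close>)
  then show ?thesis
    using d by (simp add: sums_iff)
qed

lemma Re_P_neg: "Re (P (of_real (- t))) = - Re (E t) / (2 * Re (Phi (of_real (- t))))"
  if "0 \<le> t"
proof -
  let ?z = "complex_of_real (- t)"
  have ne: "Phi ?z \<noteq> 0"
    using Phi_neg(2)[OF that] by auto
  have "P ?z = - E t / (2 * Phi ?z)"
    using ne by (simp add: P_def Q_def V_def E_def field_simps)
  also have "\<dots> = of_real (- Re (E t) / (2 * Re (Phi ?z)))"
    unfolding of_real_divide of_real_minus[of "Re (E t)"] of_real_mult of_real_numeral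
      E_real[symmetric] Phi_neg(1)[OF that, symmetric] ..
  finally show ?thesis
    by (simp only: Re_complex_of_real)
qed

text \<open>\<open>E\<close> starts at \<open>\<nu> < 0\<close> and is nonnegative at the point from
  \<open>P_nonpos_somewhere\<close>, so it has a root inside \<open>R\<close>, unique by
  monotonicity. Before the root \<open>P\<close> is positive on the negative axis, and
  \<open>Re_P_pos\<close> extends this to the disc.\<close>

lemma E_root:
  assumes "\<nu> < 0"
  obtains r where "0 < r" "r < R" "E r = 0" "\<And>t. 0 \<le> t \<Longrightarrow> E t = 0 \<Longrightarrow> t = r"
    "\<And>z. norm z < r \<Longrightarrow> Re (P z) > 0" "P (of_real (- r)) = 0"
proof -
  obtain t where t: "0 < t" "t < R" "Re (P (of_real (- t))) \<le> 0"
    using P_nonpos_somewhere assms by blast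
  then have "Re (E t) \<ge> 0"
    using Phi_neg(2)[of t] by (simp add: Re_P_neg divide_le_0_iff zero_le_divide_iff del: of_real_minus)
  moreover have "Re (E 0) \<le> 0"
    using assms by (simp add: E_def)
  moreover have "continuous_on {0..t} (\<lambda>t. Re (E t))"
    unfolding E_def by (intro continuous_intros continuous_on_compose2[OF continuous_on_Phi]
        continuous_on_compose2[OF continuous_on_Phi']) auto
  ultimately obtain r where r: "0 \<le> r" "r \<le> t" "Re (E r) = 0"
    using IVT'[of "\<lambda>t. Re (E t)" 0 0 t] t by auto
  have r0: "r > 0"
    using r assms by (cases "r = 0") (auto simp: E_def)
  have uniq: "s = r" if "0 \<le> s" "E s = 0" for s
  proof (rule ccontr)
    assume "s \<noteq> r"
    then have "Re (E s) \<noteq> Re (E r)"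
      using Re_E_strict_mono[of s r] Re_E_strict_mono[of r s] that(1) r(1) by linarith
    then show False
      using that(2) r(3) by simp
  qed
  show thesis
  proof
    show "0 < r" "r < R"
      using r0 r t by auto
    show "E r = 0"
      by (subst E_real) (simp add: r)
    show "s = r" if "0 \<le> s" "E s = 0" for s
      by (rule uniq[OF that])
    show "Re (P z) > 0" if "norm z < r" for z
    proof (rule Re_P_pos[OF assms _ _ that])
      show "Re (P (of_real (- s))) > 0" if "0 < s" "s < r" for s
        using Re_E_strict_mono[of s r] Phi_neg(2)[of s] that r by (simp add: Re_P_neg divide_less_0_iff del: of_real_minus)
    qed (use r t in auto)
    have "Re (P (of_real (- r))) = 0"
      using r by (simp add: Re_P_neg del: of_real_minus)
    moreover have "\<bar>- r\<bar> < R"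
      using r t by simp
    ultimately show "P (of_real (- r)) = 0"
      by (subst P_of_real) simp_all
  qed
qed

subsection \<open>Bessel functions\<close>

text \<open>The common prefactor of both Bessel functions; it carries the branch cut and has no zero
  away from 0.\<close>

definition C :: "complex \<Rightarrow> complex" where
  "C z = of_real (1 / Gamma (\<nu> + 1)) * (z / 2) powr of_real \<nu>"

lemma Gamma_order_pos: "Gamma (\<nu> + 1) > 0"
  using order_gt by (intro Gamma_real_pos) simp

lemma C_nonzero: "z \<noteq> 0 \<Longrightarrow> C z \<noteq> 0"
  using Gamma_order_pos by (simp add: C_def)

lemma real_exponent_power_eq:
  assumes "z \<noteq> 0"
  shows "real_exponent_power z (2 * real n + \<nu>) = (z\<^sup>2) ^ n * z powr of_real \<nu>"
proof -
  have "real_exponent_power z (2 * real n + \<nu>) = z powr of_real (2 * real n + \<nu>)"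
    unfolding real_exponent_power_def using powr_zero_eq_one[of z] assms by (metis of_real_0)
  also have "\<dots> = z powr of_nat (2 * n) * z powr of_real \<nu>"
    by (simp add: powr_add)
  also have "z powr of_nat (2 * n) = (z\<^sup>2) ^ n"
    using assms by (subst powr_nat') (auto simp: power_mult)
  finally show ?thesis .
qed

text \<open>One computation for both functions: \<open>e = -1\<close> gives \<open>Bessel_J\<close>
  and \<open>e = 1\<close> gives \<open>Bessel_I\<close>. The Gamma values are reduced to
  \<open>Gamma (\<nu> + 1)\<close> by Pochhammer symbols.\<close>

lemma Bessel_series_sums:
  assumes "z \<noteq> 0"
  shows "(\<lambda>n. e ^ n / (fact n * Gamma (of_nat n + of_real \<nu> + 1)) * real_exponent_power (z / 2) (2 * real n + \<nu>))
    sums (C z * Phi (- e * z\<^sup>2))"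
proof -
  have "e ^ n / (fact n * Gamma (of_nat n + of_real \<nu> + 1)) * real_exponent_power (z / 2) (2 * real n + \<nu>)
    = C z * (fps_nth Phi_fps n * (- e * z\<^sup>2) ^ n)" for n
  proof -
    have "\<nu> + 1 \<notin> \<int>\<^sub>\<le>\<^sub>0"
      using order_gt by (auto dest: nonpos_Ints_nonpos)
    then have "Gamma (\<nu> + 1 + real n) = pochhammer (\<nu> + 1) n * Gamma (\<nu> + 1)"
      using pochhammer_Gamma[of "\<nu> + 1" n] Gamma_order_pos by simp
    then have "Gamma (of_nat n + of_real \<nu> + 1) = complex_of_real (pochhammer (\<nu> + 1) n * Gamma (\<nu> + 1))"
      by (metis Gamma_complex_of_real add.assoc add.commute of_real_1 of_real_add of_real_of_nat_eq)
    moreover have "((z / 2)\<^sup>2) ^ n = (z\<^sup>2) ^ n / 4 ^ n"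
      by (simp add: power_divide)
    moreover have "(- e * z\<^sup>2) ^ n = (-1) ^ n * (e ^ n * (z\<^sup>2) ^ n)"
      by (simp add: power_minus[of "e * z\<^sup>2"] power_mult_distrib)
    ultimately show ?thesis
      using assms by (simp add: real_exponent_power_eq C_def Phi_fps_nth b_def) (simp add: mult_ac)
  qed
  then show ?thesis
    using sums_mult[OF Phi_sums[of "- e * z\<^sup>2"], of "C z"] by simp
qed

lemma Bessel_J_eq: "z \<noteq> 0 \<Longrightarrow> Bessel_J \<nu> z = C z * Phi (z\<^sup>2)"
  using Bessel_series_sums[of z "-1"] by (simp add: Bessel_J_def sums_iff)

lemma Bessel_I_eq: "z \<noteq> 0 \<Longrightarrow> Bessel_I \<nu> z = C z * Phi (- (z\<^sup>2))"
  using Bessel_series_sums[of z 1] by (simp add: Bessel_I_def sums_iff)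

text \<open>A positive real factor may be pulled out of a principal power, so the two branch cuts
  cancel.\<close>

lemma Bessel_Lambda_eq: "Bessel_Lambda \<nu> z = Phi (z\<^sup>2)"
proof (cases "z = 0")
  case False
  have "z powr of_real \<nu> = (of_real 2 * (z / 2)) powr of_real \<nu>"
    by simp
  also have "\<dots> = of_real 2 powr of_real \<nu> * (z / 2) powr of_real \<nu>"
    by (rule powr_times_real_left) auto
  also have "of_real 2 powr of_real \<nu> = complex_of_real (2 powr \<nu>)"
    by (rule powr_of_real) simp
  finally have "(z / 2) powr of_real \<nu> = z powr of_real \<nu> / of_real (2 powr \<nu>)"
    by simp
  then show ?thesis
    using False Gamma_order_pos by (simp add: Bessel_Lambda_def Bessel_J_eq C_def powr_minus)
qed (simp add: Bessel_Lambda_def)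

text \<open>Positive \<open>x\<close> suffices for the root equations and avoids the branch cut.
  Here \<open>e\<close> is the sign inside \<open>Phi\<close>, so \<open>e = 1\<close> belongs to
  \<open>Bessel_J\<close> and \<open>e = -1\<close> to \<open>Bessel_I\<close>.\<close>

lemma deriv_Bessel_aux:
  assumes F: "\<And>z. z \<noteq> 0 \<Longrightarrow> F z = C z * Phi (e * z\<^sup>2)" and x: "x > 0"
  shows "of_real x * deriv F (of_real x) = C (of_real x) *
    (of_real \<nu> * Phi (e * (of_real x)\<^sup>2) + 2 * e * (of_real x)\<^sup>2 * Phi' (e * (of_real x)\<^sup>2))"
proof -
  let ?z = "complex_of_real x" and ?k = "complex_of_real (1 / Gamma (\<nu> + 1))"
  define D where "D = ?k * (of_real \<nu> * (?z / 2) powr (of_real \<nu> - 1) / 2) * Phi (e * ?z\<^sup>2)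
    + C ?z * (Phi' (e * ?z\<^sup>2) * (2 * e * ?z))"
  have "((\<lambda>z. (z / 2) powr of_real \<nu>) has_field_derivative
      of_real \<nu> * (?z / 2) powr (of_real \<nu> - 1) * (1 / 2)) (at ?z)"
    by (rule DERIV_chain2[OF has_field_derivative_powr])
      (use x in \<open>auto intro!: derivative_eq_intros simp: complex_nonpos_Reals_iff\<close>)
  moreover have "((\<lambda>z. Phi (e * z\<^sup>2)) has_field_derivative Phi' (e * ?z\<^sup>2) * (2 * e * ?z)) (at ?z)"
    by (rule DERIV_chain2[OF has_derivative_Phi]) (auto intro!: derivative_eq_intros)
  ultimately have "((\<lambda>z. C z * Phi (e * z\<^sup>2)) has_field_derivative D) (at ?z)"
    unfolding C_def D_def by (rule DERIV_cong[OF DERIV_mult[OF DERIV_cmult]]) simp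
  then have "(F has_field_derivative D) (at ?z)"
    by (rule has_field_derivative_transform_within_open[of _ _ _ "- {0}"]) (use x F in auto)
  then have "deriv F ?z = D"
    by (rule DERIV_imp_deriv)
  moreover have "(?z / 2) powr (of_real \<nu> - 1) = (?z / 2) powr of_real \<nu> / (?z / 2)"
    using x by (simp add: powr_diff)
  then have "?z * (of_real \<nu> * (?z / 2) powr (of_real \<nu> - 1) / 2) = of_real \<nu> * (?z / 2) powr of_real \<nu>"
    using x by simp
  then have "?k * (?z * (of_real \<nu> * (?z / 2) powr (of_real \<nu> - 1) / 2)) * Phi (e * ?z\<^sup>2)
      = ?k * (of_real \<nu> * (?z / 2) powr of_real \<nu>) * Phi (e * ?z\<^sup>2)"
    by (simp only:)
  then have "?z * D = ?k * (of_real \<nu> * (?z / 2) powr of_real \<nu>) * Phi (e * ?z\<^sup>2)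
    + C ?z * (Phi' (e * ?z\<^sup>2) * (2 * e * ?z)) * ?z"
    unfolding D_def distrib_left by (simp only: mult_ac)
  ultimately show ?thesis
    unfolding C_def by (simp only: power2_eq_square distrib_left mult_ac)
qed

text \<open>The parameter unifies the three root equations: \<open>\<kappa>\<close> is
  \<open>\<nu> / 2\<close> for \<open>Bessel_f\<close>, \<open>1 / 2\<close> for
  \<open>Bessel_g\<close> and \<open>1\<close> for \<open>Bessel_h\<close>.\<close>

lemma deriv_Bessel_J:
  assumes "x > 0"
  shows "of_real x * deriv (Bessel_J \<nu>) (of_real x) + of_real (2 * \<kappa> - \<nu>) * Bessel_J \<nu> (of_real x)
    = 2 * C (of_real x) * (of_real \<kappa> * Phi (of_real (x\<^sup>2)) + of_real (x\<^sup>2) * Phi' (of_real (x\<^sup>2)))"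
proof -
  have "of_real x * deriv (Bessel_J \<nu>) (of_real x)
    = C (of_real x) * (of_real \<nu> * Phi (of_real (x\<^sup>2)) + 2 * of_real (x\<^sup>2) * Phi' (of_real (x\<^sup>2)))"
    using deriv_Bessel_aux[of "Bessel_J \<nu>" 1 x] Bessel_J_eq assms by simp
  moreover have "Bessel_J \<nu> (of_real x) = C (of_real x) * Phi (of_real (x\<^sup>2))"
    using Bessel_J_eq[of "of_real x"] assms by simp
  ultimately show ?thesis
    by (simp only: of_real_diff of_real_mult of_real_numeral distrib_left left_diff_distrib)
      (simp add: algebra_simps)
qed

lemma deriv_Bessel_I:
  assumes "x > 0"
  shows "of_real x * deriv (Bessel_I \<nu>) (of_real x) = C (of_real x) * E (x\<^sup>2)"
  using deriv_Bessel_aux[of "Bessel_I \<nu>" "-1" x] Bessel_I_eq assms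
  by (simp add: E_def)

lemma Bessel_J_first_zero_eq: "Bessel_J_first_zero \<nu> = sqrt R"
  unfolding Bessel_J_first_zero_def
proof (rule the_equality)
  have J: "Bessel_J \<nu> (of_real x) = 0 \<longleftrightarrow> Phi (of_real (x\<^sup>2)) = 0" if "x > 0" for x
    using that C_nonzero[of "of_real x"] by (simp add: Bessel_J_eq)
  have small: "sqrt R \<le> y" if "0 < y" "Bessel_J \<nu> (of_real y) = 0" for y
  proof (rule real_le_lsqrt)
    show "R \<le> y\<^sup>2"
      using that J[of y] Phi_nonzero[of "of_real (y\<^sup>2)"] by (cases "y\<^sup>2 < R") (auto simp del: of_real_power)
  qed (use that in auto)
  moreover have "Bessel_J \<nu> (of_real (sqrt R)) = 0"
    using J[of "sqrt R"] R_pos Phi_R by simp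
  ultimately show root: "is_smallest_positive_root (Bessel_J \<nu>) (sqrt R)"
    using R_pos by (auto simp: is_smallest_positive_root_def)
  show "x = sqrt R" if "is_smallest_positive_root (Bessel_J \<nu>) x" for x
    using that root unfolding is_smallest_positive_root_def by (meson antisym)
qed

text \<open>Below \<open>sqrt R\<close> the equation says \<open>Q (x\<^sup>2) = \<kappa>\<close>,
  and \<open>Q\<close> is strictly increasing. Any smaller positive root would also lie in that
  range.\<close>

lemma smallest_root_Bessel_J:
  assumes "0 < t" "t < R" "Re (Q (of_real t)) = \<kappa>"
  shows "is_smallest_positive_root
    (\<lambda>z. z * deriv (Bessel_J \<nu>) z + of_real (2 * \<kappa> - \<nu>) * Bessel_J \<nu> z) (sqrt t)"
proof -
  let ?G = "\<lambda>z. z * deriv (Bessel_J \<nu>) z + of_real (2 * \<kappa> - \<nu>) * Bessel_J \<nu> z"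
  have G: "?G (of_real x) = 0 \<longleftrightarrow> Re (Q (of_real (x\<^sup>2))) = \<kappa>" if x: "x > 0" "x\<^sup>2 < R" for x
  proof -
    let ?w = "complex_of_real (x\<^sup>2)"
    have ne: "Phi ?w \<noteq> 0"
      using x by (intro Phi_nonzero) (simp only: norm_of_real, simp)
    have "?G (of_real x) = 2 * C (of_real x) * (of_real \<kappa> * Phi ?w + ?w * Phi' ?w)"
      by (rule deriv_Bessel_J[OF x(1)])
    also have "of_real \<kappa> * Phi ?w + ?w * Phi' ?w = (of_real \<kappa> - Q ?w) * Phi ?w"
      using ne by (simp add: Q_def V_def field_simps)
    also have "Q ?w = of_real (Re (Q ?w))"
      using Q_of_real[of "x\<^sup>2"] x by (simp only: Re_Q_of_real) simp
    finally have "?G (of_real x) = 2 * C (of_real x) * (of_real (\<kappa> - Re (Q ?w)) * Phi ?w)"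
      by (simp only: of_real_diff)
    moreover have "2 * C (of_real x) \<noteq> 0"
      using C_nonzero[of "of_real x"] x by simp
    ultimately show ?thesis
      using ne by (auto simp del: of_real_power of_real_diff)
  qed
  have "sqrt t \<le> y" if y: "0 < y" "?G (of_real y) = 0" for y
  proof (rule ccontr)
    assume "\<not> sqrt t \<le> y"
    then have "y\<^sup>2 < t"
      using y(1) power_strict_mono[of y "sqrt t" 2] assms by simp
    then show False
      using G[OF y(1)] y Q_of_real_strict_mono[of "y\<^sup>2" t] assms by auto
  qed
  moreover have "?G (of_real (sqrt t)) = 0"
    using G[of "sqrt t"] assms by simp
  ultimately show ?thesis
    unfolding is_smallest_positive_root_def using assms by simp
qed

subsection \<open>Radii of starlikeness\<close>

lemma norm_square_less:
  fixes z :: complex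
  assumes "norm z < sqrt t"
  shows "norm (z\<^sup>2) < t"
proof -
  have "0 < sqrt t"
    using assms norm_ge_zero[of z] by linarith
  moreover have "(norm z)\<^sup>2 < (sqrt t)\<^sup>2"
    using assms by (intro power_strict_mono) auto
  ultimately show ?thesis
    by (simp add: norm_power)
qed

lemma Bessel_g_quotient:
  assumes "Phi (z\<^sup>2) \<noteq> 0"
  shows "starlike_quotient (Bessel_g \<nu>) z = 1 - 2 * Q (z\<^sup>2)"
proof (cases "z = 0")
  case False
  have "Bessel_g \<nu> = (\<lambda>z. z * Phi (z\<^sup>2))"
    by (simp add: Bessel_g_def Bessel_Lambda_eq fun_eq_iff)
  moreover have "((\<lambda>z. z * Phi (z\<^sup>2)) has_field_derivative 1 * Phi (z\<^sup>2) + Phi' (z\<^sup>2) * (2 * z) * z) (at z)"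
    by (rule DERIV_mult[OF DERIV_ident DERIV_chain2[OF has_derivative_Phi]]) (auto intro!: derivative_eq_intros)
  ultimately show ?thesis
    using False assms
    by (simp add: starlike_quotient_def DERIV_imp_deriv Q_def V_def field_simps power2_eq_square)
qed (simp add: starlike_quotient_def)

lemma Bessel_h_eq: "Bessel_h \<nu> = (\<lambda>z. z * Phi z)"
  by (simp add: Bessel_h_def Bessel_Lambda_eq fun_eq_iff)

lemma Bessel_h_quotient:
  assumes "Phi z \<noteq> 0"
  shows "starlike_quotient (Bessel_h \<nu>) z = 1 - Q z"
proof (cases "z = 0")
  case False
  have "((\<lambda>z. z * Phi z) has_field_derivative 1 * Phi z + Phi' z * z) (at z)"
    by (rule DERIV_mult[OF DERIV_ident has_derivative_Phi])
  then show ?thesis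
    using False assms
    by (simp add: starlike_quotient_def Bessel_h_eq DERIV_imp_deriv Q_def V_def field_simps)
qed (simp add: starlike_quotient_def)

lemma log_Bessel_Lambda:
  shows "log_Bessel_Lambda \<nu> holomorphic_on ball 0 (sqrt R)"
    and "norm z < sqrt R \<Longrightarrow> exp (log_Bessel_Lambda \<nu> z) = Phi (z\<^sup>2)"
proof -
  have hol: "(\<lambda>z. Phi (z\<^sup>2)) holomorphic_on ball 0 (sqrt R)"
    by (rule holomorphic_on_compose_gen[OF _ holomorphic_Phi[of UNIV], unfolded o_def])
      (auto intro!: holomorphic_intros)
  obtain g where g: "g holomorphic_on ball 0 (sqrt R)" "\<And>z. z \<in> ball 0 (sqrt R) \<Longrightarrow> exp (g z) = Phi (z\<^sup>2)"
    by (rule holomorphic_logarithm_exists[OF _ _ hol, of 0])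
      (use R_pos in \<open>auto dest!: norm_square_less dest: Phi_nonzero\<close>)
  \<comment> \<open>Subtracting \<open>g 0\<close> therefore normalizes the logarithm without
    changing its exponential, which supplies the witness for the choice operator.\<close>
  have "exp (g 0) = 1"
    using g(2)[of 0] R_pos by simp
  then have "(\<lambda>z. g z - g 0) holomorphic_on ball 0 (sqrt R) \<and> g 0 - g 0 = 0 \<and>
      (\<forall>z \<in> ball 0 (sqrt R). exp (g z - g 0) = Bessel_Lambda \<nu> z)"
    using g by (auto simp: Bessel_Lambda_eq exp_diff intro!: holomorphic_intros)
  then have "log_Bessel_Lambda \<nu> holomorphic_on ball 0 (sqrt R) \<and> log_Bessel_Lambda \<nu> 0 = 0 \<and>
      (\<forall>z \<in> ball 0 (sqrt R). exp (log_Bessel_Lambda \<nu> z) = Bessel_Lambda \<nu> z)"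
    unfolding log_Bessel_Lambda_def Bessel_J_first_zero_eq
    by (rule someI[where P = "\<lambda>L. L holomorphic_on ball 0 (sqrt R) \<and> L 0 = 0 \<and>
      (\<forall>z \<in> ball 0 (sqrt R). exp (L z) = Bessel_Lambda \<nu> z)"])
  then show "log_Bessel_Lambda \<nu> holomorphic_on ball 0 (sqrt R)"
    and "norm z < sqrt R \<Longrightarrow> exp (log_Bessel_Lambda \<nu> z) = Phi (z\<^sup>2)"
    by (auto simp: Bessel_Lambda_eq)
qed

lemma Bessel_f_eq:
  "norm z < sqrt R \<Longrightarrow> Bessel_f \<nu> z = z * exp (of_real (1 / \<nu>) * log_Bessel_Lambda \<nu> z)"
  by (simp add: Bessel_f_def Bessel_J_first_zero_eq)

lemma holomorphic_Bessel_f: "Bessel_f \<nu> holomorphic_on ball 0 (sqrt R)"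
proof -
  have "(\<lambda>z. z * exp (of_real (1 / \<nu>) * log_Bessel_Lambda \<nu> z)) holomorphic_on ball 0 (sqrt R)"
    by (intro holomorphic_intros log_Bessel_Lambda)
  then show ?thesis
    by (rule holomorphic_transform) (simp add: Bessel_f_eq)
qed

text \<open>Differentiating \<open>exp L = Phi (z\<^sup>2)\<close> in two ways gives
  \<open>z * L' = -2 * Q (z\<^sup>2)\<close> for the chosen logarithm \<open>L\<close>.\<close>

lemma Bessel_f_quotient:
  assumes z: "norm z < sqrt R"
  shows "starlike_quotient (Bessel_f \<nu>) z = 1 - of_real (2 / \<nu>) * Q (z\<^sup>2)"
proof (cases "z = 0")
  case False
  let ?L = "log_Bessel_Lambda \<nu>"
  have ne: "Phi (z\<^sup>2) \<noteq> 0"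
    by (intro Phi_nonzero norm_square_less z)
  have L: "(?L has_field_derivative deriv ?L z) (at z)"
    using log_Bessel_Lambda(1) z by (auto intro!: holomorphic_derivI)
  have "((\<lambda>z. exp (?L z)) has_field_derivative exp (?L z) * deriv ?L z) (at z)"
    by (rule DERIV_fun_exp[OF L])
  then have "((\<lambda>z. Phi (z\<^sup>2)) has_field_derivative exp (?L z) * deriv ?L z) (at z)"
    by (rule has_field_derivative_transform_within_open[of _ _ _ "ball 0 (sqrt R)"])
      (use z log_Bessel_Lambda(2) in auto)
  moreover have "((\<lambda>z. Phi (z\<^sup>2)) has_field_derivative Phi' (z\<^sup>2) * (2 * z)) (at z)"
    by (rule DERIV_chain2[OF has_derivative_Phi]) (auto intro!: derivative_eq_intros)
  ultimately have "exp (?L z) * deriv ?L z = Phi' (z\<^sup>2) * (2 * z)"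
    by (rule DERIV_unique)
  then have dL: "z * deriv ?L z = - 2 * Q (z\<^sup>2)"
    using ne log_Bessel_Lambda(2)[OF z]
    by (simp add: Q_def V_def field_simps power2_eq_square)
  define e where "e = exp (of_real (1 / \<nu>) * ?L z)"
  have "((\<lambda>z. z * exp (of_real (1 / \<nu>) * ?L z)) has_field_derivative
      1 * e + e * (of_real (1 / \<nu>) * deriv ?L z) * z) (at z)"
    unfolding e_def by (rule DERIV_mult[OF DERIV_ident DERIV_fun_exp[OF DERIV_cmult[OF L]]])
  then have "(Bessel_f \<nu> has_field_derivative
      1 * e + e * (of_real (1 / \<nu>) * deriv ?L z) * z) (at z)"
    by (rule has_field_derivative_transform_within_open[of _ _ _ "ball 0 (sqrt R)"])
      (use z Bessel_f_eq in auto)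
  then have "starlike_quotient (Bessel_f \<nu>) z
      = z * (1 * e + e * (of_real (1 / \<nu>) * deriv ?L z) * z) / (z * e)"
    using False Bessel_f_eq[OF z] by (simp add: starlike_quotient_def DERIV_imp_deriv e_def)
  also have "\<dots> = 1 + of_real (1 / \<nu>) * (z * deriv ?L z)"
    using False by (simp add: e_def field_simps)
  also have "\<dots> = 1 - of_real (2 / \<nu>) * Q (z\<^sup>2)"
    unfolding dL by simp
  finally show ?thesis .
qed (simp add: starlike_quotient_def)

text \<open>Every larger disc contains the boundary point \<open>z\<close>, where positivity fails,
  so the supremum is attained at \<open>x\<close>.\<close>

lemma radius_of_starlikeness_eqI:
  assumes "0 < x" "starlike_on_disc f x" "norm z = x" "Re (starlike_quotient f z) \<le> 0"
  shows "radius_of_starlikeness f = ereal x"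
  unfolding radius_of_starlikeness_def
proof (rule Sup_eqI)
  show "y \<le> ereal x" if "y \<in> ereal ` {r. 0 < r \<and> starlike_on_disc f r}" for y
    using that assms by (force simp: starlike_on_disc_def not_less[symmetric])
qed (use assms in auto)

lemma radius_Bessel_f_neg:
  assumes "\<nu> < 0"
  shows "\<exists>x. is_unique_positive_root (deriv (Bessel_I \<nu>)) x \<and> radius_of_starlikeness (Bessel_f \<nu>) = ereal x"
proof -
  obtain r where r: "0 < r" "r < R" "E r = 0" "\<And>t. 0 \<le> t \<Longrightarrow> E t = 0 \<Longrightarrow> t = r"
    "\<And>z. norm z < r \<Longrightarrow> Re (P z) > 0" "P (of_real (- r)) = 0"
    using E_root[OF assms] by blast
  have quot: "starlike_quotient (Bessel_f \<nu>) z = of_real (2 / - \<nu>) * P (z\<^sup>2)" if "norm z < sqrt R" for z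
    using Bessel_f_quotient[OF that] assms by (simp add: P_def algebra_simps)
  have I: "deriv (Bessel_I \<nu>) (of_real x) = 0 \<longleftrightarrow> E (x\<^sup>2) = 0" if "x > 0" for x
    using deriv_Bessel_I[OF that] C_nonzero[of "of_real x"] that by auto
  have "is_unique_positive_root (deriv (Bessel_I \<nu>)) (sqrt r)"
    unfolding is_unique_positive_root_def
  proof (intro conjI allI impI)
    show "deriv (Bessel_I \<nu>) (of_real (sqrt r)) = 0"
      using I[of "sqrt r"] r by simp
    show "y = sqrt r" if "0 < y \<and> deriv (Bessel_I \<nu>) (of_real y) = 0" for y
      using I[of y] r(4)[of "y\<^sup>2"] that by (auto simp: real_sqrt_unique)
  qed (use r in simp)
  moreover have "radius_of_starlikeness (Bessel_f \<nu>) = ereal (sqrt r)"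
  proof (rule radius_of_starlikeness_eqI)
    have lt: "norm z < sqrt R" if "norm z < sqrt r" for z :: complex
      using that r by (meson less_trans real_sqrt_less_mono)
    show "starlike_on_disc (Bessel_f \<nu>) (sqrt r)"
      unfolding starlike_on_disc_def
    proof (intro conjI ballI)
      show "Bessel_f \<nu> holomorphic_on ball 0 (sqrt r)"
        by (rule holomorphic_on_subset[OF holomorphic_Bessel_f]) (auto intro: lt)
      show "Bessel_f \<nu> z \<noteq> 0" if "z \<in> ball 0 (sqrt r) - {0}" for z
        using that by (simp add: Bessel_f_eq lt)
      show "0 < Re (starlike_quotient (Bessel_f \<nu>) z)" if "z \<in> ball 0 (sqrt r)" for z
        using quot[of z] r(5)[of "z\<^sup>2"] norm_square_less[of z r] lt[of z] that assms
        by (simp add: divide_pos_neg)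
    qed
    \<comment> \<open>The extremal point is imaginary: its square is \<open>-r\<close>, the zero of
      \<open>P\<close>.\<close>
    have "norm (\<i> * of_real (sqrt r)) < sqrt R"
      using r by (simp add: norm_mult)
    from quot[OF this] show "Re (starlike_quotient (Bessel_f \<nu>) (\<i> * of_real (sqrt r))) \<le> 0"
      using r by (simp add: power_mult_distrib flip: of_real_power)
  qed (use r in \<open>auto simp: norm_mult\<close>)
  ultimately show ?thesis
    by blast
qed

lemma radius_Bessel_f_pos:
  assumes "\<nu> > 0"
  shows "\<exists>x. is_smallest_positive_root (deriv (Bessel_J \<nu>)) x \<and> radius_of_starlikeness (Bessel_f \<nu>) = ereal x"
proof -
  obtain t where t: "0 < t" "t < R" "Re (Q (of_real t)) = \<nu> / 2"
    using Q_attains[of "\<nu> / 2"] assms by auto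
  \<comment> \<open>For \<open>\<kappa> = \<nu> / 2\<close> the coefficient
    \<open>2 * \<kappa> - \<nu>\<close> vanishes, and the remaining factor \<open>z\<close> is
    nonzero at positive points.\<close>
  have "is_smallest_positive_root (deriv (Bessel_J \<nu>)) (sqrt t)"
    using smallest_root_Bessel_J[OF t] by (auto simp: is_smallest_positive_root_def)
  moreover have "radius_of_starlikeness (Bessel_f \<nu>) = ereal (sqrt t)"
  proof (rule radius_of_starlikeness_eqI)
    have lt: "norm z < sqrt R" if "norm z < sqrt t" for z :: complex
      using that t by (meson less_trans real_sqrt_less_mono)
    show "starlike_on_disc (Bessel_f \<nu>) (sqrt t)"
      unfolding starlike_on_disc_def
    proof (intro conjI ballI)
      show "Bessel_f \<nu> holomorphic_on ball 0 (sqrt t)"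
        by (rule holomorphic_on_subset[OF holomorphic_Bessel_f]) (auto intro: lt)
      show "Bessel_f \<nu> z \<noteq> 0" if "z \<in> ball 0 (sqrt t) - {0}" for z
        using that by (simp add: Bessel_f_eq lt)
      show "0 < Re (starlike_quotient (Bessel_f \<nu>) z)" if "z \<in> ball 0 (sqrt t)" for z
        using Bessel_f_quotient[of z] Re_Q_less[of t "z\<^sup>2"] norm_square_less[of z t] lt[of z] t that assms
        by simp
    qed
    show "Re (starlike_quotient (Bessel_f \<nu>) (of_real (sqrt t))) \<le> 0"
      using Bessel_f_quotient[of "of_real (sqrt t)"] t assms by (simp flip: of_real_power)
  qed (use t in auto)
  ultimately show ?thesis
    by blast
qed

lemma radius_Bessel_g:
  "\<exists>y. is_smallest_positive_root (\<lambda>z. z * deriv (Bessel_J \<nu>) z + of_real (1 - \<nu>) * Bessel_J \<nu> z) y \<and>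
    radius_of_starlikeness (Bessel_g \<nu>) = ereal y"
proof -
  obtain t where t: "0 < t" "t < R" "Re (Q (of_real t)) = 1 / 2"
    using Q_attains[of "1 / 2"] by auto
  have "is_smallest_positive_root (\<lambda>z. z * deriv (Bessel_J \<nu>) z + of_real (1 - \<nu>) * Bessel_J \<nu> z) (sqrt t)"
    using smallest_root_Bessel_J[OF t] by simp
  moreover have "radius_of_starlikeness (Bessel_g \<nu>) = ereal (sqrt t)"
  proof (rule radius_of_starlikeness_eqI)
    have ne: "Phi (z\<^sup>2) \<noteq> 0" if "norm z \<le> sqrt t" for z
    proof -
      have "norm (z\<^sup>2) \<le> (sqrt t)\<^sup>2"
        unfolding norm_power using that by (intro power_mono) auto
      then show ?thesis
        using t by (intro Phi_nonzero) simp
    qed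
    show "starlike_on_disc (Bessel_g \<nu>) (sqrt t)"
      unfolding starlike_on_disc_def
    proof (intro conjI ballI)
      show "Bessel_g \<nu> holomorphic_on ball 0 (sqrt t)"
        unfolding Bessel_g_def[abs_def] Bessel_Lambda_eq
        by (intro holomorphic_intros holomorphic_on_compose_gen[OF _ holomorphic_Phi[of UNIV], unfolded o_def]) auto
      show "Bessel_g \<nu> z \<noteq> 0" if "z \<in> ball 0 (sqrt t) - {0}" for z
        using that ne[of z] by (simp add: Bessel_g_def Bessel_Lambda_eq)
      show "0 < Re (starlike_quotient (Bessel_g \<nu>) z)" if "z \<in> ball 0 (sqrt t)" for z
        using Bessel_g_quotient[of z] ne[of z] Re_Q_less[of t "z\<^sup>2"] norm_square_less[of z t] t that
        by simp
    qed
    show "Re (starlike_quotient (Bessel_g \<nu>) (of_real (sqrt t))) \<le> 0"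
      using Bessel_g_quotient[of "of_real (sqrt t)"] ne[of "of_real (sqrt t)"] t by (simp flip: of_real_power)
  qed (use t in auto)
  ultimately show ?thesis
    by blast
qed

text \<open>The quotient \<open>1 - Q z\<close> involves \<open>z\<close> rather than its square, so
  the radius is \<open>t\<close> while the root of the Bessel equation is
  \<open>sqrt t\<close>.\<close>

lemma radius_Bessel_h:
  "\<exists>w. is_smallest_positive_root (\<lambda>z. z * deriv (Bessel_J \<nu>) z + of_real (2 - \<nu>) * Bessel_J \<nu> z) w \<and>
    radius_of_starlikeness (Bessel_h \<nu>) = ereal (w\<^sup>2)"
proof -
  obtain t where t: "0 < t" "t < R" "Re (Q (of_real t)) = 1"
    using Q_attains[of 1] by auto
  have "is_smallest_positive_root (\<lambda>z. z * deriv (Bessel_J \<nu>) z + of_real (2 - \<nu>) * Bessel_J \<nu> z) (sqrt t)"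
    using smallest_root_Bessel_J[OF t] by simp
  moreover have "radius_of_starlikeness (Bessel_h \<nu>) = ereal ((sqrt t)\<^sup>2)"
  proof (rule radius_of_starlikeness_eqI)
    have ne: "Phi z \<noteq> 0" if "norm z \<le> t" for z
      using that t by (intro Phi_nonzero) simp
    show "starlike_on_disc (Bessel_h \<nu>) ((sqrt t)\<^sup>2)"
      unfolding starlike_on_disc_def
    proof (intro conjI ballI)
      show "Bessel_h \<nu> holomorphic_on ball 0 ((sqrt t)\<^sup>2)"
        unfolding Bessel_h_eq by (intro holomorphic_intros holomorphic_Phi)
      show "Bessel_h \<nu> z \<noteq> 0" if "z \<in> ball 0 ((sqrt t)\<^sup>2) - {0}" for z
        using that ne[of z] t by (simp add: Bessel_h_eq)
      show "0 < Re (starlike_quotient (Bessel_h \<nu>) z)" if "z \<in> ball 0 ((sqrt t)\<^sup>2)" for z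
        using Bessel_h_quotient[of z] ne[of z] Re_Q_less[of t z] t that by simp
    qed
    show "Re (starlike_quotient (Bessel_h \<nu>) (of_real t)) \<le> 0"
      using Bessel_h_quotient[of "of_real t"] ne[of "of_real t"] t by simp
  qed (use t in auto)
  ultimately show ?thesis
    by blast
qed

end

theorem corollary1:
  fixes \<nu> :: real
  shows
    "(-1 < \<nu> \<and> \<nu> < 0 \<longrightarrow>
        (\<exists>x. is_unique_positive_root (deriv (Bessel_I \<nu>)) x \<and>
             radius_of_starlikeness (Bessel_f \<nu>) = ereal x)) \<and>
     (\<nu> > 0 \<longrightarrow>
        (\<exists>x. is_smallest_positive_root (deriv (Bessel_J \<nu>)) x \<and>
             radius_of_starlikeness (Bessel_f \<nu>) = ereal x)) \<and>
     (\<nu> > -1 \<longrightarrow>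
        (\<exists>y. is_smallest_positive_root
               (\<lambda>z. z * deriv (Bessel_J \<nu>) z + of_real (1 - \<nu>) * Bessel_J \<nu> z) y \<and>
             radius_of_starlikeness (Bessel_g \<nu>) = ereal y)) \<and>
     (\<nu> > -1 \<longrightarrow>
        (\<exists>w. is_smallest_positive_root
               (\<lambda>z. z * deriv (Bessel_J \<nu>) z + of_real (2 - \<nu>) * Bessel_J \<nu> z) w \<and>
             radius_of_starlikeness (Bessel_h \<nu>) = ereal (w\<^sup>2)))"
proof (intro conjI impI)
  assume "-1 < \<nu> \<and> \<nu> < 0"
  then interpret Bessel_order \<nu> by unfold_locales simp
  show "\<exists>x. is_unique_positive_root (deriv (Bessel_I \<nu>)) x \<and>
      radius_of_starlikeness (Bessel_f \<nu>) = ereal x"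
    using radius_Bessel_f_neg \<open>-1 < \<nu> \<and> \<nu> < 0\<close> by blast
next
  assume "\<nu> > 0"
  then interpret Bessel_order \<nu> by unfold_locales simp
  show "\<exists>x. is_smallest_positive_root (deriv (Bessel_J \<nu>)) x \<and>
      radius_of_starlikeness (Bessel_f \<nu>) = ereal x"
    using radius_Bessel_f_pos \<open>\<nu> > 0\<close> by blast
next
  assume "\<nu> > -1"
  then interpret Bessel_order \<nu> by unfold_locales simp
  show "\<exists>y. is_smallest_positive_root
      (\<lambda>z. z * deriv (Bessel_J \<nu>) z + of_real (1 - \<nu>) * Bessel_J \<nu> z) y \<and>
      radius_of_starlikeness (Bessel_g \<nu>) = ereal y"
    by (rule radius_Bessel_g)
next
  assume "\<nu> > -1"
  then interpret Bessel_order \<nu> by unfold_locales simp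
  show "\<exists>w. is_smallest_positive_root
      (\<lambda>z. z * deriv (Bessel_J \<nu>) z + of_real (2 - \<nu>) * Bessel_J \<nu> z) w \<and>
      radius_of_starlikeness (Bessel_h \<nu>) = ereal (w\<^sup>2)"
    by (rule radius_Bessel_h)
qed

end
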